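(* Let $\mu$ be a diagram with $d$ boxes on the main diagonal. The Schur function $s_\mu(x)$ has the expansion $$s_\mu(x)=\sum_\lambda(-1)^{m(\lambda/\mu)}\,\psi_{\lambda/\mu}(a)\,\widehat s_\lambda(x\|a),$$ summed over diagrams $\lambda$ which contain $\mu$ and such that $\lambda$ has $d$ boxes on the main diagonal, where $m(\lambda/\mu)$ denotes the total number of boxes of $\lambda/\mu$ in rows $1,\dots,d$, and $\widehat s_\lambda(x\|a)$ are the dual Schur functions.
   Context: Let $a=(a_i)_{i\in\mathbb Z}$ be a sequence of commuting indeterminates and $\mathbb Q[a]$ the polynomial ring in the $a_i$; $x=(x_1,x_2,\dots)$. Dual Schur functions: let $\widehat\Lambda(x\|a)$ be the ring of formal (possibly infinite) sums $\sum_{\lambda}c_\lambda(a)s_\lambda(x)$, $c_\lambda(a)\in\mathbb Q[a]$, with $s_\lambda(x)$ the ordinary Schur functions. For a partition $\lambda$ with $d$ boxes on the main diagonal and $n\geqslant\ell(\lambda)$, $$\widehat s_\lambda(x_1,\dots,x_n\|a)=\frac{\det[A_{ij}]_{i,j=1}^n}{\prod_{1\leqslant i<j\leqslant n}(x_i-x_j)},$$ where $A_{ij}=\dfrac{x_i^{\lambda_j+n-j}}{(1-a_0x_i)(1-a_{-1}x_i)\cdots(1-a_{j-\lambda_j}x_i)}$ for $1\leqslant j\leqslant d$ and $A_{ij}=x_i^{\lambda_j+n-j}(1-a_1x_i)\cdots(1-a_{j-\lambda_j-1}x_i)$ for $d<j\leqslant n$; it is $0$ if $\ell(\lambda)>n$.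 These are compatible with setting $x_n=0$ and define $\widehat s_\lambda(x\|a)\in\widehat\Lambda(x\|a)$. Suppose $\mu\subseteq\lambda$ both have $d$ boxes on the main diagonal. A dual hook $\lambda/\mu$-tableau is a filling $T$ of the boxes of $\lambda/\mu$ with integers such that: the entries in the first $d$ rows strictly decrease along the rows and weakly decrease down the columns, and all entries in row $i$ belong to $\{0,-1,\dots,i-\lambda_i+1\}$ for $i=1,\dots,d$; the entries in the first $d$ columns strictly increase down the columns and weakly increase along the rows, and all entries in column $j$ belong to $\{1,2,\dots,\lambda'_j-j\}$ for $j=1,\dots,d$ ($\lambda'$ is the conjugate of $\lambda$). Then $\psi_{\lambda/\mu}(a)=\sum_T\prod_{\alpha\in\lambda/\mu}a_{T(\alpha)}$, summed over the dual hook $\lambda/\mu$-tableaux $T$. *)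

theory Defs
  imports
    "HOL-Library.Poly_Mapping"
    "HOL-Library.FuncSet"
    "Jordan_Normal_Form.Determinant"
begin

section \<open>Formal power series in countably many variables\<close>

text \<open>
  A monomial is a finitely supported exponent vector. A series is an arbitrary assignment of
  coefficients to monomials, so this is the ring of formal power series in
  \<open>X 0, X 1, X 2, \<dots>\<close>, whose elements may have unbounded degree and involve infinitely many
  variables. The variable \<open>X i\<close> plays the role of $x_{i+1}$.
\<close>

type_synonym monom_exp = "nat \<Rightarrow>\<^sub>0 nat"

typedef 'a mfps = "UNIV :: (monom_exp \<Rightarrow> 'a) set"
  morphisms coef Abs_mfps
  by simp

setup_lifting type_definition_mfps

lemma coef_Abs_mfps [simp]: "coef (Abs_mfps f) m = f m"
  by (simp add: Abs_mfps_inverse)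

lemma mfps_eqI: "(\<And>m. coef f m = coef g m) \<Longrightarrow> f = g"
  by (metis coef_inject ext)

definition splits :: "monom_exp \<Rightarrow> (monom_exp \<times> monom_exp) set" where
  "splits m = {(p, q). p + q = m}"

lemma finite_splits [simp]: "finite (splits m)"
proof -
  let ?F = "{f. \<forall>i. (i \<in> Poly_Mapping.keys m \<longrightarrow> f i \<in> {..Max (range (Poly_Mapping.lookup m))}) \<and> (i \<notin> Poly_Mapping.keys m \<longrightarrow> f i = (0::nat))}"
  have fin: "finite ?F"
    by (intro finite_set_of_finite_funs) auto
  have finr: "finite (range (Poly_Mapping.lookup m))"
  proof -
    have "range (Poly_Mapping.lookup m) \<subseteq> insert 0 (Poly_Mapping.lookup m ` Poly_Mapping.keys m)"
      by (auto simp: in_keys_iff)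
    then show ?thesis
      by (rule finite_subset) auto
  qed
  have sub: "Poly_Mapping.lookup ` fst ` splits m \<subseteq> ?F" "Poly_Mapping.lookup ` snd ` splits m \<subseteq> ?F"
  proof -
    have *: "Poly_Mapping.lookup p i \<le> Max (range (Poly_Mapping.lookup m))" "Poly_Mapping.lookup q i \<le> Max (range (Poly_Mapping.lookup m))"
      if "p + q = m" for p q i
    proof -
      have "Poly_Mapping.lookup p i + Poly_Mapping.lookup q i = Poly_Mapping.lookup m i"
        using that by (auto simp: lookup_add)
      moreover have "Poly_Mapping.lookup m i \<le> Max (range (Poly_Mapping.lookup m))"
        using finr by (intro Max_ge) auto
      ultimately show "Poly_Mapping.lookup p i \<le> Max (range (Poly_Mapping.lookup m))" "Poly_Mapping.lookup q i \<le> Max (range (Poly_Mapping.lookup m))"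
        by linarith+
    qed
    show "Poly_Mapping.lookup ` fst ` splits m \<subseteq> ?F" "Poly_Mapping.lookup ` snd ` splits m \<subseteq> ?F"
      using * by (auto simp: splits_def in_keys_iff lookup_add)
  qed
  have inj: "inj_on Poly_Mapping.lookup A" for A :: "monom_exp set"
    by (auto simp: inj_on_def lookup_inject)
  have "finite (fst ` splits m)" "finite (snd ` splits m)"
    using finite_imageD[OF finite_subset[OF sub(1) fin] inj]
      finite_imageD[OF finite_subset[OF sub(2) fin] inj] by auto
  then have "finite (fst ` splits m \<times> snd ` splits m)"
    by simp
  then show ?thesis
    by (rule rev_finite_subset) force
qed

instantiation mfps :: (comm_ring_1) comm_ring_1
begin

definition zero_mfps :: "'a mfps" where "0 = Abs_mfps (\<lambda>_. 0)"
definition one_mfps :: "'a mfps" where "1 = Abs_mfps (\<lambda>m. if m = 0 then 1 else 0)"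
definition plus_mfps :: "'a mfps \<Rightarrow> 'a mfps \<Rightarrow> 'a mfps" where
  "f + g = Abs_mfps (\<lambda>m. coef f m + coef g m)"
definition minus_mfps :: "'a mfps \<Rightarrow> 'a mfps \<Rightarrow> 'a mfps" where
  "f - g = Abs_mfps (\<lambda>m. coef f m - coef g m)"
definition uminus_mfps :: "'a mfps \<Rightarrow> 'a mfps" where
  "- f = Abs_mfps (\<lambda>m. - coef f m)"
definition times_mfps :: "'a mfps \<Rightarrow> 'a mfps \<Rightarrow> 'a mfps" where
  "f * g = Abs_mfps (\<lambda>m. \<Sum>(p, q)\<in>splits m. coef f p * coef g q)"

instance
proof
  fix f g h :: "'a mfps"
  show "f + g + h = f + (g + h)" "f + g = g + f" "0 + f = f" "- f + f = 0" "f - g = f + - g"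
    by (auto intro!: mfps_eqI simp: plus_mfps_def zero_mfps_def uminus_mfps_def minus_mfps_def)
  show "(f + g) * h = f * h + g * h"
    by (rule mfps_eqI)
      (simp add: plus_mfps_def times_mfps_def distrib_right sum.distrib case_prod_beta)
  show "f * g = g * f"
  proof (rule mfps_eqI)
    fix m
    have "(\<Sum>(p, q)\<in>splits m. coef f p * coef g q) = (\<Sum>(p, q)\<in>splits m. coef g p * coef f q)"
      by (rule sum.reindex_bij_witness[of _ prod.swap prod.swap])
        (auto simp: splits_def add.commute mult.commute)
    then show "coef (f * g) m = coef (g * f) m"
      by (simp add: times_mfps_def)
  qed
  show "f * g * h = f * (g * h)"
  proof (rule mfps_eqI)
    fix m
    have "coef (f * g * h) m
        = (\<Sum>z\<in>splits m. \<Sum>w\<in>splits (fst z). coef f (fst w) * coef g (snd w) * coef h (snd z))"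
      by (simp add: times_mfps_def case_prod_beta sum_distrib_right)
    also have "\<dots> = (\<Sum>(z, w)\<in>(SIGMA z:splits m. splits (fst z)).
        coef f (fst w) * coef g (snd w) * coef h (snd z))"
      by (subst sum.Sigma) (auto simp: case_prod_beta)
    also have "\<dots> = (\<Sum>(z, w)\<in>(SIGMA z:splits m. splits (snd z)).
        coef f (fst z) * (coef g (fst w) * coef h (snd w)))"
      by (rule sum.reindex_bij_witness[of _
            "\<lambda>((p, _), (r, s)). ((p + r, s), (p, r))" "\<lambda>((_, s), (p, r)). ((p, r + s), (r, s))"])
        (auto simp: splits_def algebra_simps)
    also have "\<dots> = (\<Sum>z\<in>splits m. \<Sum>w\<in>splits (snd z). coef f (fst z) * (coef g (fst w) * coef h (snd w)))"
      by (subst sum.Sigma) (auto simp: case_prod_beta)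
    also have "\<dots> = coef (f * (g * h)) m"
      by (simp add: times_mfps_def case_prod_beta sum_distrib_left)
    finally show "coef (f * g * h) m = coef (f * (g * h)) m" .
  qed
  show "1 * f = f"
  proof (rule mfps_eqI)
    fix m
    have "coef (1 * f) m = (\<Sum>z\<in>splits m. if z = (0, m) then coef f m else 0)"
      unfolding times_mfps_def one_mfps_def coef_Abs_mfps
      by (rule sum.cong) (auto simp: splits_def split: if_splits)
    also have "\<dots> = coef f m"
      by (subst sum.delta) (simp, simp add: splits_def)
    finally show "coef (1 * f) m = coef f m" .
  qed
  have "coef (0 :: 'a mfps) 0 \<noteq> coef 1 0"
    by (simp add: zero_mfps_def one_mfps_def)
  then show "(0 :: 'a mfps) \<noteq> 1"
    by metis
qed

end

definition Const :: "'a::comm_ring_1 \<Rightarrow> 'a mfps" where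
  "Const c = Abs_mfps (\<lambda>m. if m = 0 then c else 0)"

definition X :: "nat \<Rightarrow> 'a::comm_ring_1 mfps" where
  "X i = Abs_mfps (\<lambda>m. if m = Poly_Mapping.single i 1 then 1 else 0)"

text \<open>
  Exact quotient. It is only used for denominators that are products of factors
  \<open>1 - c X\<^sub>i\<close> (units) or Vandermonde products (non-zero-divisors, dividing every determinant
  they are applied to), so that there is exactly one such \<open>h\<close>.
\<close>

definition quot :: "'a::comm_ring_1 mfps \<Rightarrow> 'a mfps \<Rightarrow> 'a mfps" where
  "quot f g = (THE h. h * g = f)"

text \<open>Setting all variables except \<open>X 0, \<dots>, X (n - 1)\<close> to zero.\<close>

definition restrict_vars :: "nat \<Rightarrow> 'a::comm_ring_1 mfps \<Rightarrow> 'a mfps" where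
  "restrict_vars n f = Abs_mfps (\<lambda>m. if Poly_Mapping.keys m \<subseteq> {..<n} then coef f m else 0)"

text \<open>
  The series in infinitely many variables determined by a family \<open>g n\<close> of series in \<open>n\<close>
  variables that is compatible with setting the last variable to zero. It is unique because
  every monomial involves only finitely many variables.
\<close>

definition stable_limit :: "(nat \<Rightarrow> 'a::comm_ring_1 mfps) \<Rightarrow> 'a mfps" where
  "stable_limit g = (THE f. \<forall>n. restrict_vars n f = g n)"

text \<open>
  Possibly infinite sums: every monomial occurs in only finitely many summands, and
  coefficients are added up monomial by monomial. For sums of symmetric series this is the
  same as adding up formal sums of Schur functions, because each \<open>s\<^sub>\<nu>\<close>-coefficient is an
  integer combination of finitely many monomial coefficients and vice versa.
\<close>

definition has_formal_sum :: "('b \<Rightarrow> 'a::comm_ring_1 mfps) \<Rightarrow> 'b set \<Rightarrow> 'a mfps \<Rightarrow> bool" where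
  "has_formal_sum f I s \<longleftrightarrow>
     (\<forall>m. finite {i \<in> I. coef (f i) m \<noteq> 0} \<and>
          coef s m = (\<Sum>i\<in>{i \<in> I. coef (f i) m \<noteq> 0}. coef (f i) m))"


section \<open>Partitions and diagrams\<close>

text \<open>A partition is the list of its nonzero parts, so its length is \<open>length\<close>.\<close>

definition is_partition :: "nat list \<Rightarrow> bool" where
  "is_partition la \<longleftrightarrow> sorted_wrt (\<ge>) la \<and> 0 \<notin> set la"

definition part :: "nat list \<Rightarrow> nat \<Rightarrow> nat" where
  "part la i = (if 1 \<le> i \<and> i \<le> length la then la ! (i - 1) else 0)"

definition diagram :: "nat list \<Rightarrow> (nat \<times> nat) set" where
  "diagram la = {(i, j). 1 \<le> i \<and> 1 \<le> j \<and> j \<le> part la i}"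

definition conj_part :: "nat list \<Rightarrow> nat \<Rightarrow> nat" where
  "conj_part la j = card {i. (i, j) \<in> diagram la}"

definition diag_boxes :: "nat list \<Rightarrow> nat" where
  "diag_boxes la = card {i. (i, i) \<in> diagram la}"

definition skew :: "nat list \<Rightarrow> nat list \<Rightarrow> (nat \<times> nat) set" where
  "skew la mu = diagram la - diagram mu"


section \<open>Schur functions and dual Schur functions\<close>

text \<open>
  Matrix rows and variables are indexed from \<open>0\<close>; columns are shifted by \<open>Suc\<close> so that the
  column index \<open>j\<close> in the formulas below runs over \<open>1, \<dots>, n\<close>.
\<close>

definition vandermonde :: "nat \<Rightarrow> 'a::comm_ring_1 mfps" where
  "vandermonde n = (\<Prod>(i, j)\<in>{(i, j). i < j \<and> j < n}. X i - X j)"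

definition schur_vars :: "nat \<Rightarrow> nat list \<Rightarrow> 'a::comm_ring_1 mfps" where
  "schur_vars n la =
     (if n < length la then 0
      else quot (det (mat n n (\<lambda>(i, j). X i ^ (part la (Suc j) + (n - Suc j))))) (vandermonde n))"

definition schur :: "nat list \<Rightarrow> 'a::comm_ring_1 mfps" where
  "schur la = stable_limit (\<lambda>n. schur_vars n la)"

definition dual_entry ::
  "(int \<Rightarrow> 'a::comm_ring_1) \<Rightarrow> nat list \<Rightarrow> nat \<Rightarrow> nat \<Rightarrow> nat \<Rightarrow> 'a mfps" where
  "dual_entry a la n i j =
     (if j \<le> diag_boxes la
      then quot (X i ^ (part la j + (n - j)))
             (\<Prod>k\<in>{int j - int (part la j)..0}. 1 - Const (a k) * X i)
      else X i ^ (part la j + (n - j)) *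
             (\<Prod>k\<in>{1..int j - int (part la j) - 1}. 1 - Const (a k) * X i))"

definition dual_schur_vars ::
  "(int \<Rightarrow> 'a::comm_ring_1) \<Rightarrow> nat \<Rightarrow> nat list \<Rightarrow> 'a mfps" where
  "dual_schur_vars a n la =
     (if n < length la then 0
      else quot (det (mat n n (\<lambda>(i, j). dual_entry a la n i (Suc j)))) (vandermonde n))"

definition dual_schur :: "(int \<Rightarrow> 'a::comm_ring_1) \<Rightarrow> nat list \<Rightarrow> 'a mfps" where
  "dual_schur a la = stable_limit (\<lambda>n. dual_schur_vars a n la)"


section \<open>Dual hook tableaux\<close>

text \<open>
  If both diagrams have \<open>d\<close> diagonal boxes, every box of the skew diagram lies either in the
  first \<open>d\<close> rows or in the first \<open>d\<close> columns, but not in both. Fillings are extensional, so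
  that distinct functions are distinct fillings.
\<close>

definition dual_hook_tableaux :: "nat list \<Rightarrow> nat list \<Rightarrow> (nat \<times> nat \<Rightarrow> int) set" where
  "dual_hook_tableaux la mu =
     {T \<in> extensional (skew la mu).
        let d = diag_boxes mu; R = {(i, j) \<in> skew la mu. i \<le> d}; C = {(i, j) \<in> skew la mu. j \<le> d} in
          (\<forall>i j j'. (i, j) \<in> R \<and> (i, j') \<in> R \<and> j < j' \<longrightarrow> T (i, j) > T (i, j')) \<and>
          (\<forall>i i' j. (i, j) \<in> R \<and> (i', j) \<in> R \<and> i < i' \<longrightarrow> T (i, j) \<ge> T (i', j)) \<and>
          (\<forall>(i, j)\<in>R. T (i, j) \<in> {int i - int (part la i) + 1..0}) \<and>
          (\<forall>i i' j. (i, j) \<in> C \<and> (i', j) \<in> C \<and> i < i' \<longrightarrow> T (i, j) < T (i', j)) \<and>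
          (\<forall>i j j'. (i, j) \<in> C \<and> (i, j') \<in> C \<and> j < j' \<longrightarrow> T (i, j) \<le> T (i, j')) \<and>
          (\<forall>(i, j)\<in>C. T (i, j) \<in> {1..int (conj_part la j) - int j})}"

definition psi :: "(int \<Rightarrow> 'a::comm_ring_1) \<Rightarrow> nat list \<Rightarrow> nat list \<Rightarrow> 'a" where
  "psi a la mu = (\<Sum>T\<in>dual_hook_tableaux la mu. \<Prod>\<alpha>\<in>skew la mu. a (T \<alpha>))"

text \<open>The number $m(\lambda/\mu)$ of boxes in the first \<open>d\<close> rows.\<close>

definition row_boxes :: "nat list \<Rightarrow> nat list \<Rightarrow> nat" where
  "row_boxes la mu = card {(i, j) \<in> skew la mu. i \<le> diag_boxes mu}"


section \<open>The coefficient ring\<close>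

text \<open>Polynomials with rational coefficients in indeterminates indexed by the integers.\<close>

type_synonym Qa = "(int \<Rightarrow>\<^sub>0 nat) \<Rightarrow>\<^sub>0 rat"

definition indet :: "int \<Rightarrow> Qa" where
  "indet k = Poly_Mapping.single (Poly_Mapping.single k 1) 1"

end

theory Submission
  imports Defs "HOL-Computational_Algebra.Formal_Power_Series"
begin

text \<open>
  In \<open>n\<close> variables, both sides are alternants divided by the Vandermonde product. The column of
  $\widehat s_\lambda$ with index \<open>j\<close> depends only on the exponent \<open>e = \<lambda>\<^sub>j + n - j\<close>: it is the
  monomial \<open>x\<^sup>e\<close>, divided by linear factors if \<open>e \<ge> n\<close> (rows \<open>j \<le> d\<close>) and multiplied by linear
  factors otherwise. Introducing these factors one parameter at a time connects the alternant of
  $s_\mu$ with those of the $\widehat s_\lambda$. The parameter \<open>a\<^sub>k\<close> with \<open>k \<ge> 1\<close> replaces a shape by the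
  sum over the shapes obtained by adding a horizontal strip below the diagonal, and \<open>a\<^sub>k\<close> with
  \<open>k \<le> 0\<close> adds, with signs, a vertical strip above the diagonal. The strips filled with \<open>k\<close> form a
  tableau, and the bounds on its entries amount to \<open>T(i, j) \<le> i - j\<close> below the diagonal and
  \<open>T(i, j) \<ge> i - j + 1\<close> above it. A given coefficient involves only partitions of bounded first
  row, so finitely many parameters and variables suffice.
\<close>


section \<open>Power series in many variables\<close>

text \<open>The quotients are definite descriptions over an arbitrary commutative ring, so both the
  divisibility of an alternant by the Vandermonde product and the cancellability of that product
  have to be proved. Newton interpolation gives the divisibility, and its cofactor, a determinant of
  divided differences, also bounds the degree of the quotient from below; this makes the sum finite
  at each monomial in finitely many variables. The strip conditions originate in thresholds on the
  exponents: the parameter with index \<open>- l\<close> occurs only in columns with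
  \<open>n + l \<le> e\<close>, the one with index \<open>k \<ge> 1\<close> only in columns with
  \<open>e + k < n\<close>. Read off on the added boxes, these are bounds on row minus column index.
  Neither admits a box on the diagonal, so the number of diagonal boxes is preserved and entries of
  opposite sign never meet in a row or column.\<close>

lemma coef_zero [simp]: "coef 0 m = 0"
  and coef_one: "coef 1 m = (if m = 0 then 1 else 0)"
  and coef_add [simp]: "coef (f + g) m = coef f m + coef g m"
  and coef_diff [simp]: "coef (f - g) m = coef f m - coef g m"
  and coef_uminus [simp]: "coef (- f) m = - coef f m"
  and coef_mult: "coef (f * g) m = (\<Sum>(p, q)\<in>splits m. coef f p * coef g q)"
  by (simp_all add: zero_mfps_def one_mfps_def plus_mfps_def minus_mfps_def uminus_mfps_def
      times_mfps_def)

lemma coef_sum: "coef (\<Sum>x\<in>A. f x) m = (\<Sum>x\<in>A. coef (f x) m)"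
  by (induction A rule: infinite_finite_induct) auto

lemma coef_Const_mult [simp]: "coef (Const c * f) m = c * coef f m"
proof -
  have "coef (Const c * f) m = (\<Sum>z\<in>splits m. if z = (0, m) then c * coef f m else 0)"
    unfolding coef_mult Const_def coef_Abs_mfps
    by (rule sum.cong) (auto simp: splits_def split: if_splits)
  also have "\<dots> = c * coef f m"
    by (subst sum.delta) (simp, simp add: splits_def)
  finally show ?thesis .
qed

lemma coef_X_mult_add: "coef (X i * f) (m + Poly_Mapping.single i 1) = coef f m"
proof -
  let ?s = "Poly_Mapping.single i (1 :: nat)"
  have "coef (X i * f) (m + ?s) = (\<Sum>z\<in>splits (m + ?s). if z = (?s, m) then coef f m else 0)"
    unfolding coef_mult X_def coef_Abs_mfps
    by (rule sum.cong) (auto simp: splits_def add.commute split: if_splits)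
  also have "\<dots> = coef f m"
    by (subst sum.delta) (simp, simp add: splits_def add.commute)
  finally show ?thesis .
qed

lemma coef_X_mult_0:
  assumes "Poly_Mapping.lookup m i = 0"
  shows "coef (X i * f) m = 0"
  unfolding coef_mult X_def coef_Abs_mfps
  by (rule sum.neutral) (use assms in \<open>auto simp: splits_def lookup_add\<close>)

lemma monom_cases:
  fixes m :: monom_exp
  obtains "Poly_Mapping.lookup m i = 0" | m' where "m = m' + Poly_Mapping.single i 1"
proof (cases "Poly_Mapping.lookup m i = 0")
  case False
  have "m = (m - Poly_Mapping.single i 1) + Poly_Mapping.single i 1"
    using False by (intro poly_mapping_eqI) (auto simp: lookup_add lookup_minus lookup_single when_def)
  then show ?thesis
    using that by blast
qed

lemma Const_add: "Const (c + d) = Const c + Const d"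
  and Const_uminus: "Const (- c) = - Const c"
  and Const_0 [simp]: "Const 0 = 0"
  and Const_1 [simp]: "Const 1 = 1"
  by (auto intro!: mfps_eqI simp: Const_def coef_one)

lemma Const_mult: "Const (c * d) = Const c * Const d"
  by (rule mfps_eqI, subst coef_Const_mult) (simp add: Const_def)

lemma Const_power: "Const (c ^ k) = Const c ^ k"
  by (induction k) (simp_all add: Const_mult)

lemma Const_sum: "Const (\<Sum>x\<in>A. f x) = (\<Sum>x\<in>A. Const (f x))"
  by (induction A rule: infinite_finite_induct) (auto simp: Const_add)

section \<open>Total degree and order of vanishing\<close>

definition mdeg :: "monom_exp \<Rightarrow> nat" where
  "mdeg m = (\<Sum>k\<in>Poly_Mapping.keys m. Poly_Mapping.lookup m k)"

lemma mdeg_superset: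
  assumes "finite A" "Poly_Mapping.keys m \<subseteq> A"
  shows "mdeg m = (\<Sum>k\<in>A. Poly_Mapping.lookup m k)"
  unfolding mdeg_def
  by (rule sum.mono_neutral_left) (use assms in \<open>auto simp: in_keys_iff\<close>)

lemma mdeg_add: "mdeg (m + m') = mdeg m + mdeg m'"
proof -
  let ?A = "Poly_Mapping.keys m \<union> Poly_Mapping.keys m'"
  have "mdeg (m + m') = (\<Sum>k\<in>?A. Poly_Mapping.lookup (m + m') k)"
    by (rule mdeg_superset) (auto simp: in_keys_iff lookup_add)
  also have "\<dots> = mdeg m + mdeg m'"
    by (simp add: lookup_add sum.distrib mdeg_superset[of ?A m] mdeg_superset[of ?A m'])
  finally show ?thesis .
qed

lemma mdeg_single [simp]: "mdeg (Poly_Mapping.single i k) = k"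
  by (simp add: mdeg_def)

lemma keys_add_nat:
  fixes m m' :: monom_exp
  shows "Poly_Mapping.keys (m + m') = Poly_Mapping.keys m \<union> Poly_Mapping.keys m'"
  by (auto simp: in_keys_iff lookup_add)

text \<open>Controls convergence: in a fixed number of variables, a shape with a long first row
  contributes a series of high order, so only finitely many shapes reach a given monomial.\<close>

definition order_ge :: "nat \<Rightarrow> 'a::comm_ring_1 mfps \<Rightarrow> bool" where
  "order_ge r f \<longleftrightarrow> (\<forall>m. mdeg m < r \<longrightarrow> coef f m = 0)"

lemma order_ge_mult:
  assumes "order_ge r f"
  shows "order_ge r (f * g)"
  unfolding order_ge_def
proof (intro allI impI)
  fix m assume m: "mdeg m < r"
  show "coef (f * g) m = 0"
    unfolding coef_mult
  proof (rule sum.neutral, clarify)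
    fix p q assume "(p, q) \<in> splits m"
    then have "mdeg p < r"
      using m by (auto simp: splits_def mdeg_add)
    then show "coef f p * coef g q = 0"
      using assms by (simp add: order_ge_def)
  qed
qed

lemma order_ge_sum: "(\<And>x. x \<in> A \<Longrightarrow> order_ge r (f x)) \<Longrightarrow> order_ge r (\<Sum>x\<in>A. f x)"
  by (simp add: order_ge_def coef_sum)

text \<open>
  The divided difference of a one-variable series over the variables in a finite set: the complete
  homogeneous polynomials replace the powers of the variable.
\<close>

definition divdiff :: "nat set \<Rightarrow> 'a::comm_ring_1 fps \<Rightarrow> 'a mfps" where
  "divdiff S f = Abs_mfps (\<lambda>m. if Poly_Mapping.keys m \<subseteq> S
     then fps_nth f (mdeg m + (card S - 1)) else 0)"

text \<open>For one variable the index shift \<open>card S - 1\<close> is zero, so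
  \<open>X i ^ k\<close> receives the coefficient \<open>fps_nth f k\<close>: this is the
  substitution of \<open>X i\<close> into \<open>f\<close>.\<close>

abbreviation subst_var :: "nat \<Rightarrow> 'a::comm_ring_1 fps \<Rightarrow> 'a mfps" where
  "subst_var i \<equiv> divdiff {i}"

lemma divdiff_add: "divdiff S (f + g) = divdiff S f + divdiff S g"
  and divdiff_diff: "divdiff S (f - g) = divdiff S f - divdiff S g"
  and divdiff_const_mult: "divdiff S (fps_const c * f) = Const c * divdiff S f"
  by (rule mfps_eqI, simp add: divdiff_def)+

text \<open>At a monomial \<open>m\<close> in these variables that contains \<open>X k\<close>, the
  coefficient of \<open>X k * ?D\<close> is \<open>fps_nth f (mdeg m + card S)\<close> for either
  choice of \<open>k\<close>: dividing by \<open>X k\<close> lowers the degree by one, and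
  \<open>?D\<close> has two more variables than \<open>S\<close>. On both sides only the monomials
  containing exactly one of \<open>X i\<close> and \<open>X j\<close> survive.\<close>

lemma divdiff_recurrence:
  assumes "finite S" "i \<notin> S" "j \<notin> S" "i \<noteq> j"
  shows "divdiff (insert i S) f - divdiff (insert j S) f
       = (X i - X j) * divdiff (insert i (insert j S)) f"
proof (rule mfps_eqI)
  fix m
  let ?D = "divdiff (insert i (insert j S)) f"
  have XD: "coef (X k * ?D) m = (if Poly_Mapping.lookup m k = 0 then 0
      else if Poly_Mapping.keys m \<subseteq> insert i (insert j S) then fps_nth f (mdeg m + card S) else 0)"
    if "k \<in> {i, j}" for k
  proof (cases m k rule: monom_cases)
    case 1
    then show ?thesis by (simp add: coef_X_mult_0)
  next
    case (2 m')
    then show ?thesis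
      using assms that
      by (auto simp: coef_X_mult_add lookup_add divdiff_def mdeg_add keys_add_nat simp del: One_nat_def,
          simp_all)
  qed
  have *: "Poly_Mapping.keys m \<subseteq> insert k S \<longleftrightarrow>
      Poly_Mapping.keys m \<subseteq> insert i (insert j S) \<and> Poly_Mapping.lookup m k' = 0"
    if "(k, k') = (i, j) \<or> (k, k') = (j, i)" for k k'
    using that assms by (auto simp: in_keys_iff subset_iff) (metis neq0_conv)+
  have "coef (divdiff (insert k S) f) m = (if Poly_Mapping.keys m \<subseteq> insert i (insert j S) \<and>
      Poly_Mapping.lookup m k' = 0 then fps_nth f (mdeg m + card S) else 0)"
    if "(k, k') = (i, j) \<or> (k, k') = (j, i)" for k k'
    using *[OF that] that assms unfolding divdiff_def by auto
  from this[of i j] this[of j i] XD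
  show "coef (divdiff (insert i S) f - divdiff (insert j S) f) m = coef ((X i - X j) * ?D) m"
    by (simp add: left_diff_distrib)
qed

lemma subst_var_X_mult: "subst_var i (fps_X * f) = X i * subst_var i f"
proof (rule mfps_eqI)
  fix m
  show "coef (subst_var i (fps_X * f)) m = coef (X i * subst_var i f) m"
  proof (cases m i rule: monom_cases)
    case 1
    then have "Poly_Mapping.keys m \<subseteq> {i} \<Longrightarrow> m = 0"
      by (metis in_keys_iff keys_eq_empty subset_singletonD insertI1)
    with 1 show ?thesis by (auto simp: coef_X_mult_0 divdiff_def mdeg_def)
  next
    case (2 m')
    then show ?thesis
      by (simp add: coef_X_mult_add divdiff_def mdeg_add keys_add_nat del: One_nat_def)
  qed
qed

lemma subst_var_1 [simp]: "subst_var i 1 = 1"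
proof (rule mfps_eqI)
  fix m
  have "mdeg m = 0 \<longleftrightarrow> m = 0"
    by (auto simp: mdeg_def in_keys_iff intro!: poly_mapping_eqI)
  then show "coef (subst_var i 1) m = coef 1 m"
    by (auto simp: divdiff_def coef_one)
qed

lemma subst_var_X_power: "subst_var i (fps_X ^ k) = X i ^ k"
  by (induction k) (simp_all add: subst_var_X_mult)

lemma subst_var_linear_factor:
  "subst_var i ((1 - fps_const c * fps_X) * f) = (1 - Const c * X i) * subst_var i f"
  by (simp add: left_diff_distrib divdiff_diff divdiff_const_mult subst_var_X_mult mult.assoc)

lemma subst_var_prod_linear_factors:
  assumes "finite A"
  shows "subst_var i ((\<Prod>k\<in>A. 1 - fps_const (c k) * fps_X) * f)
       = (\<Prod>k\<in>A. 1 - Const (c k) * X i) * subst_var i f"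
  using assms by (induction A) (simp_all add: mult.assoc subst_var_linear_factor)

section \<open>Non-zero-divisors and the exact quotient\<close>

definition nonzerodiv :: "'a::comm_ring_1 \<Rightarrow> bool" where
  "nonzerodiv v \<longleftrightarrow> (\<forall>x. x * v = 0 \<longrightarrow> x = 0)"

lemma nonzerodiv_cancel:
  assumes "nonzerodiv v" "x * v = y * v"
  shows "x = y"
  using assms unfolding nonzerodiv_def by (metis eq_iff_diff_eq_0 left_diff_distrib)

lemma nonzerodiv_mult: "nonzerodiv u \<Longrightarrow> nonzerodiv v \<Longrightarrow> nonzerodiv (u * v)"
  unfolding nonzerodiv_def by (metis mult.assoc)

lemma nonzerodiv_prod: "(\<And>x. x \<in> A \<Longrightarrow> nonzerodiv (f x)) \<Longrightarrow> nonzerodiv (\<Prod>x\<in>A. f x)"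
  by (induction A rule: infinite_finite_induct) (auto simp: nonzerodiv_mult, auto simp: nonzerodiv_def)

lemma nonzerodiv_unit: "u * v = 1 \<Longrightarrow> nonzerodiv v"
  unfolding nonzerodiv_def by (metis mult.assoc mult.commute mult_1 mult_zero_left)

lemma nonzerodiv_X: "nonzerodiv (X i :: 'a::comm_ring_1 mfps)"
  unfolding nonzerodiv_def
  by (metis coef_X_mult_add coef_zero mfps_eqI mult.commute)

text \<open>If \<open>X i * f = X j * f\<close>, replacing a factor \<open>X j\<close> of a monomial
  by \<open>X i\<close> preserves the coefficient of \<open>f\<close>. Once no \<open>X j\<close> is
  left, the coefficient equals one of \<open>X j * f\<close> at a monomial free of
  \<open>X j\<close>, which is 0.\<close>

lemma nonzerodiv_X_diff:
  assumes "i \<noteq> j"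
  shows "nonzerodiv (X i - X j :: 'a::comm_ring_1 mfps)"
  unfolding nonzerodiv_def
proof (intro allI impI)
  fix f :: "'a mfps" assume "f * (X i - X j) = 0"
  then have eq: "X i * f = X j * f"
    by (simp add: algebra_simps)
  have "coef f m = 0" if "Poly_Mapping.lookup m j = k" for k m
    using that
  proof (induction k arbitrary: m)
    case 0
    have "coef f m = coef (X j * f) (m + Poly_Mapping.single i 1)"
      by (simp add: coef_X_mult_add flip: eq del: One_nat_def)
    also have "\<dots> = 0"
      using 0 assms by (intro coef_X_mult_0) (simp add: lookup_add lookup_single)
    finally show ?case .
  next
    case (Suc k)
    then obtain m' where m': "m = m' + Poly_Mapping.single j 1"
      by (cases m j rule: monom_cases) auto
    have "coef f m = coef (X j * f) (m + Poly_Mapping.single i 1)"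
      by (simp add: coef_X_mult_add flip: eq del: One_nat_def)
    also have "m + Poly_Mapping.single i 1 = (m' + Poly_Mapping.single i 1) + Poly_Mapping.single j 1"
      by (simp add: m' ac_simps)
    also have "coef (X j * f) \<dots> = coef f (m' + Poly_Mapping.single i 1)"
      by (rule coef_X_mult_add)
    also have "\<dots> = 0"
      using Suc assms by (intro Suc.IH) (simp add: m' lookup_add lookup_single)
    finally show ?case .
  qed
  then show "f = 0"
    by (auto intro: mfps_eqI)
qed

lemma nonzerodiv_vandermonde: "nonzerodiv (vandermonde n)"
  unfolding vandermonde_def by (intro nonzerodiv_prod) (auto simp: nonzerodiv_X_diff)

lemma quot_eqI: "nonzerodiv g \<Longrightarrow> h * g = f \<Longrightarrow> quot f g = h"
  unfolding quot_def by (metis (mono_tags, lifting) nonzerodiv_cancel the_equality)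


section \<open>Alternants and stability\<close>

text \<open>The recurrence for divided differences splits the remainder into the next Newton term
  and a new remainder. The signs come from writing the factors as \<open>X j - X i\<close>, the
  orientation they have in the Vandermonde product.\<close>

lemma newton_interpolation_remainder:
  assumes "k \<le> i"
  shows "subst_var i f = (\<Sum>l<k. (-1) ^ l * divdiff {..l} f * (\<Prod>j<l. X j - X i))
    + (-1) ^ k * divdiff (insert i {..<k}) f * (\<Prod>j<k. X j - X i)"
  using assms
proof (induction k)
  case (Suc k)
  have "divdiff (insert i {..<k}) f - divdiff {..k} f = (X i - X k) * divdiff (insert i {..<Suc k}) f"
    using divdiff_recurrence[of "{..<k}" i k f] Suc.prems
    by (simp add: lessThan_Suc flip: lessThan_Suc_atMost)
  then have eq: "divdiff (insert i {..<k}) f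
      = divdiff {..k} f - (X k - X i) * divdiff (insert i {..<Suc k}) f"
    by (simp add: algebra_simps)
  then show ?case
    using Suc unfolding eq by (simp add: algebra_simps)
qed auto

text \<open>At \<open>k = i\<close> the remainder is itself the Newton term with index
  \<open>i\<close>, and all later terms contain the factor \<open>X i - X i\<close>. So the sum may
  run to \<open>n\<close> for every row \<open>i\<close>, as a matrix product requires.\<close>

lemma newton_interpolation:
  fixes f :: "'a::comm_ring_1 fps"
  assumes "i < n"
  shows "subst_var i f = (\<Sum>k<n. (-1) ^ k * divdiff {..k} f * (\<Prod>j<k. X j - X i))"
proof -
  have "subst_var i f = (\<Sum>k<Suc i. (-1) ^ k * divdiff {..k} f * (\<Prod>j<k. X j - X i))"
    using newton_interpolation_remainder[of i i f]
    by (simp add: lessThan_Suc flip: lessThan_Suc_atMost)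
  also have "\<dots> = (\<Sum>k<n. (-1) ^ k * divdiff {..k} f * (\<Prod>j<k. X j - X i))"
  proof (rule sum.mono_neutral_left)
    have "(\<Prod>j<k. X j - X i :: 'a mfps) = 0" if "i < k" for k
      using that by (intro prod_zero) auto
    then show "\<forall>k\<in>{..<n} - {..<Suc i}. (-1) ^ k * divdiff {..k} f * (\<Prod>j<k. X j - X i) = 0"
      by auto
  qed (use assms in auto)
  finally show ?thesis .
qed

lemma vandermonde_eq_iterated_prod:
  "vandermonde n = (\<Prod>j<n. \<Prod>i<j. X i - X j)"
proof -
  have "(\<Prod>j<n. \<Prod>i<j. X i - X j :: 'a mfps)
      = (\<Prod>(j, i)\<in>(SIGMA j:{..<n}. {..<j}). X i - X j)"
    by (subst prod.Sigma) auto
  also have "\<dots> = vandermonde n"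
    unfolding vandermonde_def
    by (rule prod.reindex_bij_witness[of _ prod.swap prod.swap]) auto
  finally show ?thesis ..
qed

abbreviation alternant :: "nat \<Rightarrow> (nat \<Rightarrow> 'a::comm_ring_1 fps) \<Rightarrow> 'a mfps" where
  "alternant n f \<equiv> det (mat n n (\<lambda>(i, j). subst_var i (f j)))"

text \<open>Newton interpolation factors the alternant matrix, with a triangular Vandermonde factor.\<close>

lemma vandermonde_dvd_alternant:
  obtains h where "alternant n f = h * vandermonde n"
    and "\<And>r j. j < n \<Longrightarrow> (\<And>e. e < r + n - 1 \<Longrightarrow> fps_nth (f j) e = 0) \<Longrightarrow> order_ge r h"
proof -
  define L where "L = mat n n (\<lambda>(i, k). \<Prod>j<k. X j - X i :: 'a mfps)"
  define B where "B = mat n n (\<lambda>(k, j). (-1) ^ k * divdiff {..k} (f j))"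
  have LB: "L \<in> carrier_mat n n" "B \<in> carrier_mat n n"
    by (simp_all add: L_def B_def)
  have "mat n n (\<lambda>(i, j). subst_var i (f j)) = L * B"
  proof (rule eq_matI)
    fix i j assume "i < dim_row (L * B)" "j < dim_col (L * B)"
    then have ij: "i < n" "j < n"
      by (simp_all add: L_def B_def)
    have "(L * B) $$ (i, j) = (\<Sum>k<n. (-1) ^ k * divdiff {..k} (f j) * (\<Prod>j<k. X j - X i))"
      using ij by (simp add: L_def B_def scalar_prod_def atLeast0LessThan mult_ac)
    also have "\<dots> = subst_var i (f j)"
      by (rule newton_interpolation[OF ij(1), symmetric])
    finally show "mat n n (\<lambda>(i, j). subst_var i (f j)) $$ (i, j) = (L * B) $$ (i, j)"
      using ij by simp
  qed (simp_all add: L_def B_def)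
  then have "alternant n f = det L * det B"
    by (simp add: det_mult[OF LB])
  also have "det L = prod_list (diag_mat L)"
  proof (rule det_lower_triangular[OF _ LB(1)])
    fix i j assume "i < j" "j < n"
    moreover from this have "(\<Prod>k<j. X k - X i :: 'a mfps) = 0"
      by (intro prod_zero) auto
    ultimately show "L $$ (i, j) = 0"
      by (simp add: L_def)
  qed
  also have "\<dots> = vandermonde n"
    by (simp add: diag_mat_def L_def prod.list_conv_set_nth vandermonde_eq_iterated_prod
        atLeast0LessThan)
  finally have 1: "alternant n f = det B * vandermonde n"
    by (simp add: mult.commute)
  \<comment> \<open>Every term of the Leibniz expansion contains an entry of column
    \<open>j\<close>, so it is enough to bound the order of the entries of that column.\<close>
  have 2: "order_ge r (det B)" if j: "j < n" and f: "\<And>e. e < r + n - 1 \<Longrightarrow> fps_nth (f j) e = 0" for r j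
    unfolding det_def'[OF LB(2)]
  proof (rule order_ge_sum)
    fix p assume "p \<in> {p. p permutes {0..<n}}"
    then have p: "p permutes {0..<n}" by simp
    obtain k where k: "k < n" "p k = j"
    proof -
      have "j \<in> p ` {0..<n}"
        using j by (simp add: permutes_image[OF p])
      then show ?thesis
        using that by auto
    qed
    \<comment> \<open>\<open>divdiff {..k}\<close> lowers degrees by \<open>k \<le> n - 1\<close>;
      this is the source of the offset \<open>n - 1\<close>.\<close>
    have "order_ge r (divdiff {..k} (f j))"
      unfolding order_ge_def using k f by (auto simp: divdiff_def)
    then have "order_ge r (divdiff {..k} (f j) * ((-1) ^ k * (signof p * (\<Prod>i\<in>{0..<n} - {k}. B $$ (i, p i)))))"
      by (rule order_ge_mult)
    also have "\<dots> = signof p * (\<Prod>i = 0..<n. B $$ (i, p i))"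
      using k j by (subst prod.remove[of _ k]) (auto simp: B_def mult_ac)
    finally show "order_ge r (signof p * (\<Prod>i = 0..<n. B $$ (i, p i)))" .
  qed
  show ?thesis
    by (rule that[OF 1 2])
qed

lemma quot_alternant: "quot (alternant n f) (vandermonde n) * vandermonde n = alternant n f"
proof -
  obtain h where h: "alternant n f = h * vandermonde n"
    by (rule vandermonde_dvd_alternant[of n f])
  then have "quot (alternant n f) (vandermonde n) = h"
    by (intro quot_eqI[OF nonzerodiv_vandermonde]) simp
  then show ?thesis
    by (simp add: h)
qed

lemma order_ge_quot_alternant:
  assumes "j < n" "\<And>e. e < r + n - 1 \<Longrightarrow> fps_nth (f j) e = 0"
  shows "order_ge r (quot (alternant n f) (vandermonde n))"
proof -
  obtain h where h: "alternant n f = h * vandermonde n" and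
    *: "\<And>r j. j < n \<Longrightarrow> (\<And>e. e < r + n - 1 \<Longrightarrow> fps_nth (f j) e = 0) \<Longrightarrow> order_ge r h"
    by (rule vandermonde_dvd_alternant[of n f]) blast
  have "quot (alternant n f) (vandermonde n) = h"
    by (intro quot_eqI[OF nonzerodiv_vandermonde]) (simp add: h)
  moreover have "order_ge r h"
    by (rule *[OF assms])
  ultimately show ?thesis
    by simp
qed

section \<open>Setting variables to zero, and compatible families\<close>

lemma coef_restrict_vars:
  "coef (restrict_vars n f) m = (if Poly_Mapping.keys m \<subseteq> {..<n} then coef f m else 0)"
  by (simp add: restrict_vars_def)

lemma restrict_vars_mult: "restrict_vars n (f * g) = restrict_vars n f * restrict_vars n g"
proof (rule mfps_eqI)
  fix m
  show "coef (restrict_vars n (f * g)) m = coef (restrict_vars n f * restrict_vars n g) m"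
    unfolding coef_mult coef_restrict_vars
    by (auto simp: splits_def keys_add_nat intro!: sum.cong sum.neutral)
qed

interpretation restrict_vars: comm_ring_hom "restrict_vars n"
  by unfold_locales
    (auto intro!: mfps_eqI simp: restrict_vars_mult, auto simp: coef_restrict_vars coef_one)

lemma restrict_vars_subst_var:
  "restrict_vars n (subst_var i f) = (if i < n then subst_var i f else Const (fps_nth f 0))"
proof (rule mfps_eqI)
  fix m :: monom_exp
  have "Poly_Mapping.keys m \<subseteq> {i} \<Longrightarrow> \<not> i < n \<Longrightarrow> Poly_Mapping.keys m \<subseteq> {..<n} \<Longrightarrow> m = 0"
    by (metis empty_iff insertI1 keys_eq_empty lessThan_iff subsetD subset_singletonD)
  then show "coef (restrict_vars n (subst_var i f)) m
      = coef (if i < n then subst_var i f else Const (fps_nth f 0)) m"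
    by (auto simp: coef_restrict_vars divdiff_def Const_def mdeg_def)
qed

lemma X_eq_subst_var: "X i = subst_var i fps_X"
  by (metis mult.right_neutral subst_var_1 subst_var_X_mult)

lemma restrict_vars_X: "restrict_vars n (X i) = (if i < n then X i else 0)"
  unfolding X_eq_subst_var restrict_vars_subst_var by simp

lemma restrict_vars_vandermonde_Suc:
  "restrict_vars n (vandermonde (Suc n)) = vandermonde n * (\<Prod>i<n. X i)"
  by (simp add: vandermonde_eq_iterated_prod restrict_vars.hom_prod restrict_vars.hom_minus restrict_vars_X restrict_vars_mult)

lemma permutes_lessD:
  fixes n :: nat
  shows "p permutes {0..<n} \<Longrightarrow> i < n \<Longrightarrow> p i < n"
  using permutes_in_image[of p "{0..<n}" i] by simp

lemma alternant_shift: "alternant n (\<lambda>j. fps_X * f j) = (\<Prod>i<n. X i) * alternant n f"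
proof -
  have "alternant n (\<lambda>j. fps_X * f j) = (\<Sum>p | p permutes {0..<n}.
      signof p * (\<Prod>i = 0..<n. X i * subst_var i (f (p i))))"
    by (subst det_def'[of _ n]) (auto intro!: sum.cong prod.cong simp: subst_var_X_mult permutes_lessD)
  also have "\<dots> = (\<Prod>i<n. X i) * (\<Sum>p | p permutes {0..<n}.
      signof p * (\<Prod>i = 0..<n. subst_var i (f (p i))))"
    by (simp add: prod.distrib sum_distrib_left mult_ac atLeast0LessThan)
  also have "(\<Sum>p | p permutes {0..<n}. signof p * (\<Prod>i = 0..<n. subst_var i (f (p i))))
      = alternant n f"
    by (subst det_def'[of _ n]) (auto intro!: sum.cong prod.cong simp: permutes_lessD)
  finally show ?thesis .
qed

text \<open>With the last variable set to 0, the last row consists of constant terms, of which only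
  that of \<open>f n\<close> can be nonzero; Laplace expansion along this row leaves the smaller
  alternant.\<close>

lemma restrict_vars_alternant_Suc:
  assumes "\<And>j. j < n \<Longrightarrow> fps_nth (f j) 0 = 0"
  shows "restrict_vars n (alternant (Suc n) f) = Const (fps_nth (f n) 0) * alternant n f"
proof -
  define A where "A = map_mat (restrict_vars n) (mat (Suc n) (Suc n) (\<lambda>(i, j). subst_var i (f j)))"
  have A: "A \<in> carrier_mat (Suc n) (Suc n)"
    by (simp add: A_def)
  have "restrict_vars n (alternant (Suc n) f) = det A"
    unfolding A_def restrict_vars.hom_det ..
  also have "\<dots> = (\<Sum>j<Suc n. A $$ (n, j) * cofactor A n j)"
    by (rule laplace_expansion_row[OF A]) simp
  also have "\<dots> = A $$ (n, n) * cofactor A n n"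
    using assms by (auto simp: A_def restrict_vars_subst_var intro!: sum.neutral)
  also have "A $$ (n, n) = Const (fps_nth (f n) 0)"
    by (simp add: A_def restrict_vars_subst_var)
  also have "mat_delete A n n = mat n n (\<lambda>(i, j). subst_var i (f j))"
    by (rule eq_matI) (auto simp: A_def mat_delete_def restrict_vars_subst_var)
  then have "cofactor A n n = alternant n f"
    by (simp add: cofactor_def flip: mult_2)
  finally show ?thesis .
qed

lemma restrict_vars_restrict_vars: "k \<le> n \<Longrightarrow> restrict_vars k (restrict_vars n f) = restrict_vars k f"
  by (rule mfps_eqI) (auto simp: coef_restrict_vars)

lemma restrict_vars_stable_limit:
  assumes 1: "\<And>n. restrict_vars n (g (Suc n)) = g n"
  shows "restrict_vars n (stable_limit g) = g n"
proof -
  have 2: "restrict_vars n (g n) = g n" for n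
    using restrict_vars_restrict_vars[OF order_refl, of n "g (Suc n)"] by (simp add: 1)
  have 3: "restrict_vars n (g N) = g n" if "n \<le> N" for n N
    using that
  proof (induction N rule: dec_induct)
    case base
    show ?case by (rule 2)
  next
    case (step N)
    then have "restrict_vars n (restrict_vars N (g (Suc N))) = g n"
      by (simp add: 1)
    then show ?case
      using step by (simp add: restrict_vars_restrict_vars)
  qed
  \<comment> \<open>\<open>bound m\<close> exceeds the index of every variable in \<open>m\<close>,
    so all members of the family from there on agree at \<open>m\<close>.\<close>
  define bound where "bound = (\<lambda>m :: monom_exp. Suc (Max (insert 0 (Poly_Mapping.keys m))))"
  have bound: "Poly_Mapping.keys m \<subseteq> {..<bound m}" for m
    by (auto simp: bound_def less_Suc_eq_le)
  define f where "f = Abs_mfps (\<lambda>m. coef (g (bound m)) m)"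
  have f: "restrict_vars n f = g n" for n
  proof (rule mfps_eqI)
    fix m
    show "coef (restrict_vars n f) m = coef (g n) m"
    proof (cases "Poly_Mapping.keys m \<subseteq> {..<n}")
      case True
      have "coef (g (max n (bound m))) m = coef (g n) m"
        using True by (simp add: coef_restrict_vars flip: 3[of n "max n (bound m)"])
      moreover have "coef (g (max n (bound m))) m = coef (g (bound m)) m"
        using bound by (simp add: coef_restrict_vars flip: 3[of "bound m" "max n (bound m)"])
      ultimately show ?thesis
        using True by (simp add: coef_restrict_vars f_def)
    next
      case False
      then show ?thesis
        by (subst 2[symmetric]) (simp add: coef_restrict_vars)
    qed
  qed
  have uniq: "f' = f" if "\<forall>n. restrict_vars n f' = g n" for f'
  proof (rule mfps_eqI)
    fix m
    have "coef (restrict_vars (bound m) f') m = coef (restrict_vars (bound m) f) m"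
      using that f by simp
    then show "coef f' m = coef f m"
      by (simp add: coef_restrict_vars bound)
  qed
  have "stable_limit g = f"
    unfolding stable_limit_def by (rule the_equality) (use f uniq in auto)
  with f show ?thesis by simp
qed


section \<open>Dual Schur functions as alternants\<close>

definition geometric :: "'a::comm_ring_1 \<Rightarrow> 'a fps" where
  "geometric c = Abs_fps (\<lambda>k. c ^ k)"

lemma linear_factor_geometric: "(1 - fps_const c * fps_X) * geometric c = 1"
proof (rule fps_ext)
  fix k
  show "fps_nth ((1 - fps_const c * fps_X) * geometric c) k = fps_nth 1 k"
    by (cases k) (simp_all add: geometric_def left_diff_distrib mult.assoc)
qed

text \<open>Interpolates between the monomials (\<open>K = L = 0\<close>) and the columns of the
  dual Schur alternants: \<open>K\<close> counts the parameters \<open>a 0, a (-1), ...\<close>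
  already switched on, \<open>L\<close> the parameters \<open>a 1, a 2, ...\<close>. For
  \<open>e = part la j + (n - j)\<close> the test \<open>n \<le> e\<close> says
  \<open>j \<le> part la j\<close>, and \<open>e - n + 1\<close> or \<open>n - 1 - e\<close> is the
  full number of factors in column \<open>j\<close>.\<close>

definition hook_basis :: "(int \<Rightarrow> 'a::comm_ring_1) \<Rightarrow> nat \<Rightarrow> nat \<Rightarrow> nat \<Rightarrow> nat \<Rightarrow> 'a fps" where
  "hook_basis a K L n e = fps_X ^ e *
     (if n \<le> e then \<Prod>l<min (e - n + 1) K. geometric (a (- int l))
      else \<Prod>k\<in>{1..min (n - 1 - e) L}. 1 - fps_const (a (int k)) * fps_X)"

text \<open>The caps \<open>Suc e\<close> and \<open>n\<close> are large enough never to cut off a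
  factor.\<close>

definition dual_basis :: "(int \<Rightarrow> 'a::comm_ring_1) \<Rightarrow> nat \<Rightarrow> nat \<Rightarrow> 'a fps" where
  "dual_basis a n e = hook_basis a (Suc e) n n e"

lemma hook_basis_eq_dual_basis:
  assumes "e < n + K" "n \<le> Suc (L + e)"
  shows "hook_basis a K L n e = dual_basis a n e"
proof (cases "n \<le> e")
  case True
  then have "min (e - n + 1) K = min (e - n + 1) (Suc e)"
    using assms by auto
  with True show ?thesis
    by (simp add: dual_basis_def hook_basis_def)
next
  case False
  have "min (n - 1 - e) L = min (n - 1 - e) n"
    using assms by auto
  with False show ?thesis
    by (simp add: dual_basis_def hook_basis_def)
qed

lemma hook_basis_0_0: "hook_basis a 0 0 n e = fps_X ^ e"
  by (simp add: hook_basis_def)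

text \<open>Apart from the power of the variable, the series depends only on the difference of
  \<open>e\<close> and \<open>n\<close>. This is what makes the dual Schur functions compatible with
  adding a variable.\<close>

lemma dual_basis_Suc_Suc: "dual_basis a (Suc n) (Suc e) = fps_X * dual_basis a n e"
proof -
  have "min (Suc e - Suc n + 1) (Suc (Suc e)) = min (e - n + 1) (Suc e)"
    "min (Suc n - 1 - Suc e) (Suc n) = min (n - 1 - e) n"
    by auto
  then show ?thesis
    by (simp add: dual_basis_def hook_basis_def mult.assoc)
qed

lemma fps_nth_hook_basis: "i < e \<Longrightarrow> fps_nth (hook_basis a K L n e) i = 0"
  by (simp add: hook_basis_def fps_X_power_mult_nth)

lemma fps_nth_dual_basis_0: "fps_nth (dual_basis a n e) 0 = (if e = 0 then 1 else 0)"
proof (cases "e = 0")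
  case True
  have "fps_nth (\<Prod>k\<in>A. f k) 0 = (\<Prod>k\<in>A. fps_nth (f k) 0)" for A and f :: "nat \<Rightarrow> 'a fps"
    by (induction A rule: infinite_finite_induct) auto
  then show ?thesis
    using True by (simp add: dual_basis_def hook_basis_def geometric_def)
qed (simp add: dual_basis_def fps_nth_hook_basis)

lemma dual_basis_zero: "dual_basis (\<lambda>_. 0) n e = fps_X ^ e"
proof -
  have "geometric (0 :: 'a) = 1"
    using linear_factor_geometric[of "0 :: 'a"] by simp
  then show ?thesis
    by (simp add: dual_basis_def hook_basis_def)
qed

lemma downset_eq_atLeastAtMost:
  fixes A :: "nat set"
  assumes "finite A" "\<And>i. i \<in> A \<Longrightarrow> 1 \<le> i" "\<And>i k. i \<in> A \<Longrightarrow> 1 \<le> k \<Longrightarrow> k \<le> i \<Longrightarrow> k \<in> A"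
  shows "A = {1..card A}"
proof (cases "A = {}")
  case False
  have A: "A = {1..Max A}"
  proof (intro equalityI subsetI)
    fix k assume "k \<in> A"
    then show "k \<in> {1..Max A}"
      using assms(1,2) by simp
  next
    fix k assume "k \<in> {1..Max A}"
    then show "k \<in> A"
      using assms(3)[OF Max_in[OF assms(1) False]] by simp
  qed
  have "card A = card {1..Max A}"
    by (rule arg_cong[OF A])
  then show ?thesis
    using A by simp
qed simp

lemma part_antimono:
  assumes "is_partition la" "1 \<le> i" "i \<le> i'"
  shows "part la i' \<le> part la i"
proof (cases "i = i'")
  case False
  then show ?thesis
    using assms sorted_wrt_nth_less[of "(\<ge>)" la "i - 1" "i' - 1"]
    by (auto simp: part_def is_partition_def)
qed simp

lemma part_pos_iff: "is_partition la \<Longrightarrow> 0 < part la i \<longleftrightarrow> 1 \<le> i \<and> i \<le> length la"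
  by (auto simp: part_def is_partition_def) (metis gr0I nth_mem Suc_pred less_eq_Suc_le)

text \<open>Parts decrease, so the indices of diagonal boxes form an initial interval. The case
  split on the number of diagonal boxes thereby becomes a condition on a single part.\<close>

lemma le_diag_boxes_iff:
  assumes "is_partition la" "1 \<le> j"
  shows "j \<le> diag_boxes la \<longleftrightarrow> j \<le> part la j"
proof -
  let ?A = "{i. (i, i) \<in> diagram la}"
  have "?A \<subseteq> {1..length la}"
    using part_pos_iff[OF assms(1)] by (auto simp: diagram_def) fastforce
  then have "finite ?A"
    by (rule finite_subset) simp
  then have A: "?A = {1..card ?A}"
  proof (rule downset_eq_atLeastAtMost)
    fix i k assume "i \<in> ?A" "1 \<le> k" "k \<le> i"
    then show "k \<in> ?A"
      using part_antimono[OF assms(1), of k i] by (auto simp: diagram_def)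
  qed (auto simp: diagram_def)
  have "j \<in> ?A \<longleftrightarrow> j \<in> {1..diag_boxes la}"
    unfolding diag_boxes_def by (rule arg_cong[OF A])
  then show ?thesis
    using assms by (auto simp: diagram_def)
qed

lemma dual_entry_eq_subst_var:
  assumes "is_partition la" "1 \<le> j" "j \<le> n"
  shows "dual_entry a la n i j = subst_var i (dual_basis a n (part la j + (n - j)))"
proof (cases "j \<le> part la j")
  case True
  define c where "c = part la j - j"
  define e where "e = part la j + (n - j)"
  have e: "e = n + c"
    using True assms by (simp add: e_def c_def)
  let ?P = "\<Prod>l<Suc c. 1 - Const (a (- int l)) * X i"
  let ?G = "\<Prod>l<Suc c. geometric (a (- int l))"
  have P: "(\<Prod>k\<in>{int j - int (part la j)..0}. 1 - Const (a k) * X i) = ?P"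
    by (rule prod.reindex_bij_witness[of _ "\<lambda>l. - int l" "\<lambda>k. nat (- k)"])
      (use True in \<open>auto simp: c_def\<close>)
  have "?P * subst_var i (?G * f)
      = subst_var i ((\<Prod>l<Suc c. (1 - fps_const (a (- int l)) * fps_X) * geometric (a (- int l))) * f)" for f
    by (simp only: subst_var_prod_linear_factors[symmetric] finite_lessThan prod.distrib mult.assoc)
  \<comment> \<open>The geometric series invert the denominator factor by factor. This shows both
    that \<open>?P\<close> is cancellable and what the quotient is.\<close>
  then have PG: "subst_var i (?G * f) * ?P = subst_var i f" for f
    by (subst mult.commute) (simp add: linear_factor_geometric del: prod.lessThan_Suc)
  have "nonzerodiv ?P"
    using PG[of 1] by (intro nonzerodiv_unit[of "subst_var i (?G * 1)"]) simp
  then have "quot (X i ^ e) ?P = subst_var i (?G * fps_X ^ e)"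
    by (rule quot_eqI) (simp only: PG subst_var_X_power)
  moreover have "min (e - n + 1) (Suc e) = Suc c"
    by (simp add: e)
  ultimately show ?thesis
    using True assms P e
    by (simp add: dual_entry_def le_diag_boxes_iff dual_basis_def hook_basis_def mult.commute
        flip: e_def del: prod.lessThan_Suc)
next
  case False
  define e where "e = part la j + (n - j)"
  have "(\<Prod>k\<in>{1..int j - int (part la j) - 1}. 1 - Const (a k) * X i)
      = (\<Prod>k\<in>{1..n - 1 - e}. 1 - Const (a (int k)) * X i)"
    by (rule prod.reindex_bij_witness[of _ int nat]) (use False assms in \<open>auto simp: e_def\<close>)
  moreover have "\<not> n \<le> e" "min (n - 1 - e) n = n - 1 - e"
    using False assms by (auto simp: e_def)
  moreover have "subst_var i (fps_X ^ e * (\<Prod>k\<in>{1..n - 1 - e}. 1 - fps_const (a (int k)) * fps_X))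
      = X i ^ e * (\<Prod>k\<in>{1..n - 1 - e}. 1 - Const (a (int k)) * X i)"
    by (subst (1 2) mult.commute) (simp add: subst_var_prod_linear_factors subst_var_X_power)
  ultimately show ?thesis
    using False assms
    by (simp add: dual_entry_def le_diag_boxes_iff dual_basis_def hook_basis_def flip: e_def)
qed

lemma alternant_cong:
  assumes "\<And>j. j < n \<Longrightarrow> f j = g j"
  shows "alternant n f = alternant n g"
  using assms by (intro arg_cong[of _ _ det] cong_mat) auto

lemma dual_schur_vars_eq:
  assumes "is_partition la"
  shows "dual_schur_vars a n la = (if n < length la then 0 else
    quot (alternant n (\<lambda>j. dual_basis a n (part la (Suc j) + (n - Suc j)))) (vandermonde n))"
proof -
  have "mat n n (\<lambda>(i, j). dual_entry a la n i (Suc j))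
      = mat n n (\<lambda>(i, j). subst_var i (dual_basis a n (part la (Suc j) + (n - Suc j))))"
    by (rule cong_mat) (use assms in \<open>auto simp: dual_entry_eq_subst_var\<close>)
  then show ?thesis
    by (simp add: dual_schur_vars_def)
qed

text \<open>The two sides are compared after multiplication by the restriction of the larger
  Vandermonde product, which is \<open>vandermonde n\<close> times the product of the variables. The
  latter also appears in the alternant, since with one more variable each exponent rises by
  one.\<close>

lemma restrict_vars_dual_schur_vars:
  assumes la: "is_partition la"
  shows "restrict_vars n (dual_schur_vars a (Suc n) la) = dual_schur_vars a n la"
proof (cases "Suc n < length la")
  case False
  let ?f = "\<lambda>n j. dual_basis a n (part la (Suc j) + (n - Suc j))"
  \<comment> \<open>The last column has exponent \<open>part la (Suc n)\<close>, so
    \<open>?c\<close> is 1 if \<open>la\<close> has at most \<open>n\<close> rows and 0 otherwise;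
    in the second case both sides vanish.\<close>
  let ?c = "fps_nth (?f (Suc n) n) 0"
  have X: "nonzerodiv (\<Prod>i<n. X i :: 'a mfps)"
    by (intro nonzerodiv_prod nonzerodiv_X)
  have f: "?f (Suc n) j = fps_X * ?f n j" if "j < n" for j
  proof -
    have "part la (Suc j) + (Suc n - Suc j) = Suc (part la (Suc j) + (n - Suc j))"
      using that by simp
    then show ?thesis
      by (simp only: dual_basis_Suc_Suc)
  qed
  have "restrict_vars n (dual_schur_vars a (Suc n) la) * (vandermonde n * (\<Prod>i<n. X i))
      = restrict_vars n (alternant (Suc n) (?f (Suc n)))"
    using False
    by (simp add: dual_schur_vars_eq[OF la] quot_alternant
        flip: restrict_vars_vandermonde_Suc restrict_vars_mult)
  also have "\<dots> = Const ?c * alternant n (?f (Suc n))"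
    by (rule restrict_vars_alternant_Suc) (simp add: fps_nth_dual_basis_0)
  also have "alternant n (?f (Suc n)) = (\<Prod>i<n. X i) * alternant n (?f n)"
    by (subst alternant_shift[symmetric], rule alternant_cong) (rule f)
  also have "Const ?c * \<dots> = dual_schur_vars a n la * (vandermonde n * (\<Prod>i<n. X i))"
  proof (cases "n < length la")
    case True
    then have "?c = 0"
      using part_pos_iff[OF la, of "Suc n"] by (simp add: fps_nth_dual_basis_0)
    then show ?thesis
      using True by (simp add: dual_schur_vars_eq[OF la])
  next
    case False
    then have "?c = 1"
      by (simp add: fps_nth_dual_basis_0 part_def)
    moreover have "alternant n (?f n) = dual_schur_vars a n la * vandermonde n"
      using False by (simp add: dual_schur_vars_eq[OF la] quot_alternant)
    ultimately show ?thesis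
      by (simp only: Const_1 mult_ac mult_1)
  qed
  finally show ?thesis
    by (rule nonzerodiv_cancel[OF nonzerodiv_mult[OF nonzerodiv_vandermonde X]])
qed (simp add: dual_schur_vars_def)

lemma coef_dual_schur:
  assumes "is_partition la" "Poly_Mapping.keys m \<subseteq> {..<n}"
  shows "coef (dual_schur a la) m = coef (dual_schur_vars a n la) m"
  using arg_cong[OF restrict_vars_stable_limit[of "\<lambda>n. dual_schur_vars a n la" n,
      OF restrict_vars_dual_schur_vars], of "\<lambda>f. coef f m"] assms
  by (simp add: dual_schur_def coef_restrict_vars)

text \<open>Without parameters all columns are monomials. Stability of the ordinary Schur functions
  is thus inherited from the dual ones.\<close>

lemma schur_eq_dual_schur:
  assumes "is_partition la"
  shows "(schur la :: 'a::comm_ring_1 mfps) = dual_schur (\<lambda>_. 0) la"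
proof -
  have "(schur_vars n la :: 'a mfps) = dual_schur_vars (\<lambda>_. 0) n la" for n
    by (simp add: dual_schur_vars_eq[OF assms] schur_vars_def dual_basis_zero subst_var_X_power)
  then show ?thesis
    by (simp add: schur_def dual_schur_def)
qed


section \<open>Adding strips to a shape\<close>

text \<open>Zero padding supplies the exponents of the columns that belong to empty rows. Rows are
  numbered from 1; fixing \<open>p 0 = 0\<close> makes the function representing a partition
  unique.\<close>

definition shape :: "nat \<Rightarrow> (nat \<Rightarrow> nat) \<Rightarrow> bool" where
  "shape n p \<longleftrightarrow> p 0 = 0 \<and> (\<forall>i>n. p i = 0) \<and> (\<forall>i\<ge>1. p (Suc i) \<le> p i)"

definition boxes :: "(nat \<Rightarrow> nat) \<Rightarrow> (nat \<times> nat) set" where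
  "boxes p = {(i, j). 1 \<le> i \<and> 1 \<le> j \<and> j \<le> p i}"

text \<open>Besides bounding the entry, the condition fixes its side of the diagonal:
  \<open>v \<le> 0\<close> forces the column index to exceed the row index, \<open>v > 0\<close> the
  reverse. On a diagonal box no value satisfies it.\<close>

definition flag :: "int \<Rightarrow> nat \<times> nat \<Rightarrow> bool" where
  "flag v b \<longleftrightarrow> (if v \<le> 0 then int (fst b) - int (snd b) < v else v \<le> int (fst b) - int (snd b))"

text \<open>The strips are the sets of boxes that a single entry \<open>v\<close> of a tableau may occupy.\<close>

definition strip :: "int \<Rightarrow> (nat \<Rightarrow> nat) \<Rightarrow> (nat \<Rightarrow> nat) \<Rightarrow> bool" where
  "strip v r q \<longleftrightarrow> (\<forall>i. r i \<le> q i) \<and> (\<forall>b\<in>boxes q - boxes r. flag v b) \<and>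
     (if v \<le> 0 then \<forall>i. q i \<le> Suc (r i) else \<forall>i\<ge>1. q (Suc i) \<le> r i)"

lemma boxes_diff_eq_Sigma:
  assumes "shape n q"
  shows "boxes q - boxes r = (SIGMA i:{1..n}. {r i<..q i})"
proof -
  have "i \<le> n" if "1 \<le> j" "j \<le> q i" for i j
    using assms that by (cases "n < i") (auto simp: shape_def)
  then show ?thesis
    by (auto simp: boxes_def)
qed

lemma card_boxes_diff:
  assumes "shape n q"
  shows "card (boxes q - boxes r) = (\<Sum>j<n. q (Suc j) - r (Suc j))"
proof -
  have "card (boxes q - boxes r) = (\<Sum>i\<in>{1..n}. q i - r i)"
    by (simp add: boxes_diff_eq_Sigma[OF assms])
  also have "\<dots> = (\<Sum>j<n. q (Suc j) - r (Suc j))"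
    by (rule sum.reindex_bij_witness[of _ Suc "\<lambda>i. i - 1"]) auto
  finally show ?thesis .
qed

lemma finite_bounded_shapes: "finite {q. shape n q \<and> (\<forall>i. q i \<le> M)}"
proof (rule finite_subset)
  show "{q. shape n q \<and> (\<forall>i. q i \<le> M)}
      \<subseteq> {q. \<forall>i. (i \<in> {..n} \<longrightarrow> q i \<in> {..M}) \<and> (i \<notin> {..n} \<longrightarrow> q i = 0)}"
    by (auto simp: shape_def)
qed (intro finite_set_of_finite_funs; simp)

lemma shape_bounded:
  assumes "shape n q"
  obtains M where "\<And>i. q i \<le> M"
proof (rule that)
  show "q i \<le> Max (q ` {..n})" for i
    using assms by (cases "i \<le> n") (auto simp: shape_def)
qed

lemma finite_boxes_diff: "shape n q \<Longrightarrow> finite (boxes q - boxes r)"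
  by (simp add: boxes_diff_eq_Sigma)

text \<open>Multilinearity in the columns. A choice of one summand per column is stored as a
  function on \<open>1, ..., n\<close> padded with zeros, the form in which it can be compared with
  a shape.\<close>

lemma det_columns_sum:
  fixes G :: "nat \<Rightarrow> nat \<Rightarrow> nat \<Rightarrow> 'a::comm_ring_1"
  assumes "\<And>j. j < n \<Longrightarrow> finite (S j)"
  shows "det (mat n n (\<lambda>(i, j). \<Sum>s\<in>S j. c j s * G i j s)) =
    (\<Sum>q | q 0 = 0 \<and> (\<forall>i>n. q i = 0) \<and> (\<forall>j<n. q (Suc j) \<in> S j).
      (\<Prod>j<n. c j (q (Suc j))) * det (mat n n (\<lambda>(i, j). G i j (q (Suc j)))))"
    (is "det ?A = (\<Sum>q\<in>?Q. _)")
proof -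
  let ?P = "{p. p permutes {0..<n}}"
  have "det ?A = (\<Sum>p\<in>?P. signof p * (\<Prod>j<n. \<Sum>s\<in>S j. c j s * G (p j) j s))"
    by (subst det_col[of _ n]) (auto intro!: sum.cong prod.cong simp: permutes_lessD)
  also have "\<dots> = (\<Sum>p\<in>?P. signof p * (\<Sum>g\<in>PiE {..<n} S. \<Prod>j<n. c j (g j) * G (p j) j (g j)))"
    by (subst prod_sum_PiE) (use assms in auto)
  also have "\<dots> = (\<Sum>g\<in>PiE {..<n} S. \<Sum>p\<in>?P. signof p * (\<Prod>j<n. c j (g j) * G (p j) j (g j)))"
    by (simp add: sum_distrib_left sum.swap[of _ _ ?P])
  also have "\<dots> = (\<Sum>q\<in>?Q. \<Sum>p\<in>?P. signof p *
      (\<Prod>j<n. c j (q (Suc j)) * G (p j) j (q (Suc j))))"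
    by (rule sum.reindex_bij_witness[of _ "\<lambda>q. \<lambda>j\<in>{..<n}. q (Suc j)"
          "\<lambda>g i. if i = 0 \<or> n < i then 0 else g (i - 1)"])
      (auto simp: fun_eq_iff PiE_iff extensional_def gr0_conv_Suc intro!: sum.cong prod.cong)
  also have "\<dots> = (\<Sum>q\<in>?Q. (\<Prod>j<n. c j (q (Suc j))) * det (mat n n (\<lambda>(i, j). G i j (q (Suc j)))))"
  proof (rule sum.cong[OF refl])
    fix q
    have "det (mat n n (\<lambda>(i, j). G i j (q (Suc j))))
        = (\<Sum>p\<in>?P. signof p * (\<Prod>j<n. G (p j) j (q (Suc j))))"
      by (subst det_col[of _ n]) (auto intro!: sum.cong prod.cong simp: permutes_lessD)
    then show "(\<Sum>p\<in>?P. signof p * (\<Prod>j<n. c j (q (Suc j)) * G (p j) j (q (Suc j))))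
        = (\<Prod>j<n. c j (q (Suc j))) * det (mat n n (\<lambda>(i, j). G i j (q (Suc j))))"
      by (simp add: prod.distrib sum_distrib_left mult_ac)
  qed
  finally show ?thesis .
qed

abbreviation shape_det :: "nat \<Rightarrow> (nat \<Rightarrow> nat \<Rightarrow> 'a::comm_ring_1) \<Rightarrow> (nat \<Rightarrow> nat) \<Rightarrow> 'a" where
  "shape_det n F q \<equiv> det (mat n n (\<lambda>(i, j). F i (q (Suc j) + (n - Suc j))))"

text \<open>Each column beyond the threshold splits into the exponents \<open>e\<close> and
  \<open>e + 1\<close>: its row keeps its length or gains one box. Choices that are not shapes give
  determinants with two equal columns.\<close>

lemma vertical_strip_expansion:
  fixes F F' :: "nat \<Rightarrow> nat \<Rightarrow> 'a::comm_ring_1"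
  assumes r: "shape n r"
    and F: "\<And>i e. n + l \<le> e \<Longrightarrow> F i e = F' i e + \<alpha> * F' i (Suc e)" "\<And>i e. e < n + l \<Longrightarrow> F i e = F' i e"
  shows "shape_det n F r = (\<Sum>q | shape n q \<and> strip (- int l) r q.
     \<alpha> ^ card (boxes q - boxes r) * shape_det n F' q)"
proof -
  \<comment> \<open>For the exponent of column \<open>j\<close> the threshold
    \<open>n + l \<le> e\<close> reads \<open>Suc j + l \<le> r (Suc j)\<close>, which is
    \<open>flag (- int l)\<close> at the next box of row \<open>Suc j\<close>.\<close>
  define S where "S j = (if Suc j + l \<le> r (Suc j) then {r (Suc j), Suc (r (Suc j))} else {r (Suc j)})" for j
  let ?Q = "{q. q 0 = 0 \<and> (\<forall>i>n. q i = 0) \<and> (\<forall>j<n. q (Suc j) \<in> S j)}"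
  let ?w = "\<lambda>q. \<Prod>j<n. \<alpha> ^ (q (Suc j) - r (Suc j))"
  have r': "r (Suc i) \<le> r i" if "1 \<le> i" for i
    using r that by (simp add: shape_def)
  have Q: "r i \<le> q i" "q i \<le> Suc (r i)" "q i = Suc (r i) \<Longrightarrow> i + l \<le> r i" if "q \<in> ?Q" for q i
  proof -
    have "q i = r i" if "i = 0 \<or> n < i"
      using \<open>q \<in> ?Q\<close> r that by (auto simp: shape_def)
    moreover have "q i \<in> S (i - 1)" if "\<not> (i = 0 \<or> n < i)"
      using \<open>q \<in> ?Q\<close> that by (cases i) auto
    ultimately show "r i \<le> q i" "q i \<le> Suc (r i)" "q i = Suc (r i) \<Longrightarrow> i + l \<le> r i"
      by (cases "i = 0 \<or> n < i"; auto simp: S_def split: if_splits)+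
  qed
  have Q_shape: "{q. shape n q \<and> strip (- int l) r q} = {q \<in> ?Q. shape n q}"
  proof (intro equalityI subsetI)
    fix q assume q: "q \<in> {q. shape n q \<and> strip (- int l) r q}"
    have "q (Suc j) \<in> S j" for j
    proof -
      have "r (Suc j) \<le> q (Suc j)" "q (Suc j) \<le> Suc (r (Suc j))"
        using q by (auto simp: strip_def)
      moreover have "Suc j + l \<le> r (Suc j)" if "q (Suc j) = Suc (r (Suc j))"
      proof -
        have "(Suc j, Suc (r (Suc j))) \<in> boxes q - boxes r"
          using that by (simp add: boxes_def)
        then have "flag (- int l) (Suc j, Suc (r (Suc j)))"
          using q by (auto simp: strip_def)
        then show ?thesis
          by (simp add: flag_def)
      qed
      ultimately show ?thesis
        by (auto simp: S_def le_Suc_eq)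
    qed
    then show "q \<in> {q \<in> ?Q. shape n q}"
      using q by (auto simp: shape_def)
  next
    fix q assume "q \<in> {q \<in> ?Q. shape n q}"
    then have q: "q \<in> ?Q" "shape n q" by auto
    have "flag (- int l) b" if b: "b \<in> boxes q - boxes r" for b
    proof -
      obtain i j where b: "b = (i, j)" "\<not> j \<le> r i" "j \<le> q i"
        using b by (auto simp: boxes_def)
      then have "q i = Suc (r i)" "j = q i"
        using Q(1,2)[OF q(1), of i] by auto
      then show ?thesis
        using Q(3)[OF q(1), of i] by (simp add: flag_def b)
    qed
    then show "q \<in> {q. shape n q \<and> strip (- int l) r q}"
      using q(2) Q(1,2)[OF q(1)] by (simp add: strip_def)
  qed
  have fin: "finite ?Q"
  proof (rule finite_subset)
    show "?Q \<subseteq> {q. \<forall>i. (i \<in> {1..n} \<longrightarrow> q i \<in> (\<Union>j<n. S j)) \<and> (i \<notin> {1..n} \<longrightarrow> q i = 0)}"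
    proof (intro subsetI CollectI allI conjI impI)
      fix q i assume q: "q \<in> ?Q"
      show "q i \<in> (\<Union>j<n. S j)" if i: "i \<in> {1..n}"
      proof -
        obtain j where "i = Suc j" "j < n"
          using i by (cases i) auto
        then show ?thesis
          using q by (intro UN_I[of j]) auto
      qed
      show "q i = 0" if "i \<notin> {1..n}"
        using q that by (cases i) auto
    qed
    show "finite {q. \<forall>i. (i \<in> {1..n} \<longrightarrow> q i \<in> (\<Union>j<n. S j)) \<and> (i \<notin> {1..n} \<longrightarrow> q i = 0)}"
      by (intro finite_set_of_finite_funs) (auto simp: S_def)
  qed
  have "shape_det n F r = det (mat n n (\<lambda>(i, j). \<Sum>s\<in>S j. \<alpha> ^ (s - r (Suc j)) * F' i (s + (n - Suc j))))"
    by (intro arg_cong[of _ _ det] cong_mat) (auto simp: S_def F Suc_diff_Suc)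
  also have "\<dots> = (\<Sum>q\<in>?Q. ?w q * shape_det n F' q)"
    by (rule det_columns_sum) (simp add: S_def)
  also have "\<dots> = (\<Sum>q | shape n q \<and> strip (- int l) r q. ?w q * shape_det n F' q)"
    unfolding Q_shape
  proof (rule sum.mono_neutral_right[OF fin])
    show "\<forall>q\<in>?Q - {q \<in> ?Q. shape n q}. ?w q * shape_det n F' q = 0"
    proof
      fix q assume "q \<in> ?Q - {q \<in> ?Q. shape n q}"
      then have q: "q \<in> ?Q" and "\<not> shape n q" by auto
      then obtain i where i: "1 \<le> i" "q i < q (Suc i)"
        by (auto simp: shape_def not_le)
      \<comment> \<open>A choice fails to be a shape only if a row grows while the equally long row
        above it does not; both then have the same exponent.\<close>
      have "q (Suc i) = Suc (q i)"
        using i r'[OF i(1)] Q(1)[OF q, of i] Q(2)[OF q, of "Suc i"] by linarith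
      moreover have "Suc i \<le> n"
        using q i(2) by (cases "n < Suc i") auto
      ultimately have "shape_det n F' q = 0"
        using i(1)
        by (intro det_identical_columns[of _ n "i - 1" i]) (auto intro!: eq_vecI simp: Suc_diff_Suc)
      then show "?w q * shape_det n F' q = 0" by simp
    qed
  qed auto
  also have "\<dots> = (\<Sum>q | shape n q \<and> strip (- int l) r q.
     \<alpha> ^ card (boxes q - boxes r) * shape_det n F' q)"
    by (rule sum.cong) (auto simp: card_boxes_diff power_sum)
  finally show ?thesis .
qed

text \<open>
  Subtracting from every column a multiple of its left neighbour shortens the telescoping sums, so
  that the expanded determinants are indexed exactly by horizontal strips.
\<close>

lemma horizontal_strip_expansion:
  fixes F F' :: "nat \<Rightarrow> nat \<Rightarrow> 'a::comm_ring_1"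
  assumes r: "shape n r" and k: "1 \<le> k"
    and F: "\<And>i e. e + k < n \<Longrightarrow> F i e = F' i e + \<alpha> * F i (Suc e)" "\<And>i e. n \<le> e + k \<Longrightarrow> F i e = F' i e"
  shows "shape_det n F r = (\<Sum>q | shape n q \<and> strip (int k) r q.
     \<alpha> ^ card (boxes q - boxes r) * shape_det n F' q)"
proof -
  \<comment> \<open>\<open>s \<le> r j\<close> is the interlacing condition of a horizontal strip,
    and \<open>s + k \<le> Suc j\<close> is \<open>flag\<close> at the last box of a lengthened row
    \<open>Suc j\<close>. The first row, \<open>j = 0\<close>, has no row above it.\<close>
  define S where "S j = {s. r (Suc j) \<le> s \<and> (1 \<le> j \<longrightarrow> s \<le> r j) \<and> (s = r (Suc j) \<or> s + k \<le> Suc j)}" for j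
  let ?Q = "{q. q 0 = 0 \<and> (\<forall>i>n. q i = 0) \<and> (\<forall>j<n. q (Suc j) \<in> S j)}"
  have r': "r (Suc i) \<le> r i" if "1 \<le> i" for i
    using r that by (simp add: shape_def)
  have finS: "finite (S j)" for j
    by (rule finite_subset[of _ "insert (r (Suc j)) {..Suc j}"]) (auto simp: S_def)
  have Q_shape: "?Q = {q. shape n q \<and> strip (int k) r q}"
  proof (intro equalityI subsetI)
    fix q assume q: "q \<in> {q. shape n q \<and> strip (int k) r q}"
    have "q (Suc j) \<in> S j" for j
    proof -
      have "r (Suc j) \<le> q (Suc j)" "1 \<le> j \<Longrightarrow> q (Suc j) \<le> r j"
        using q k by (auto simp: strip_def)
      moreover have "q (Suc j) + k \<le> Suc j" if "r (Suc j) < q (Suc j)"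
      proof -
        have "(Suc j, q (Suc j)) \<in> boxes q - boxes r"
          using that by (simp add: boxes_def)
        then have "flag (int k) (Suc j, q (Suc j))"
          using q by (auto simp: strip_def)
        then show ?thesis
          using k by (simp add: flag_def)
      qed
      ultimately show ?thesis
        by (cases "r (Suc j) < q (Suc j)") (auto simp: S_def)
    qed
    then show "q \<in> ?Q"
      using q by (auto simp: shape_def)
  next
    fix q assume q: "q \<in> ?Q"
    have qS: "q i \<in> S (i - 1)" if "1 \<le> i" "i \<le> n" for i
      using q that by (cases i) auto
    have le: "r i \<le> q i" for i
    proof (cases "i = 0 \<or> n < i")
      case True
      then show ?thesis using r by (auto simp: shape_def)
    next
      case False
      then show ?thesis
        using qS[of i] by (simp add: S_def)
    qed
    have ge: "q (Suc i) \<le> r i" if "1 \<le> i" for i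
      using q that by (cases "i < n") (auto simp: S_def)
    have "flag (int k) b" if b: "b \<in> boxes q - boxes r" for b
    proof -
      obtain i j where b: "b = (i, j)" "1 \<le> i" "\<not> j \<le> r i" "j \<le> q i"
        using b by (auto simp: boxes_def)
      then have "i \<le> n"
        using q by (cases "n < i") auto
      then have "q i \<in> S (i - 1)"
        using qS b(2) by blast
      then show ?thesis
        using b k by (auto simp: S_def flag_def)
    qed
    moreover have "shape n q"
      using q le ge unfolding shape_def by (auto intro: order_trans)
    ultimately show "q \<in> {q. shape n q \<and> strip (int k) r q}"
      using le ge k by (simp add: strip_def)
  qed
  \<comment> \<open>The second term of the recurrence is again a value of \<open>F\<close>, so the
    recurrence can be unrolled, up to the exponent \<open>n - k\<close>, from which on
    \<open>F\<close> and \<open>F'\<close> agree.\<close>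
  have telescope: "F i e - \<alpha> ^ (t - e) * F i t = (\<Sum>s\<in>{e..<t}. \<alpha> ^ (s - e) * F' i s)"
    if "e \<le> t" "t + k \<le> n" for i e t
    using that
  proof (induction t rule: dec_induct)
    case (step t)
    then have "F i t = F' i t + \<alpha> * F i (Suc t)"
      by (intro F(1)) simp
    then show ?case
      using step by (simp add: Suc_diff_le algebra_simps)
  qed simp
  have telescope': "F i e = (\<Sum>s\<in>{e..<Suc (n - k)}. \<alpha> ^ (s - e) * F' i s)"
    if "e + k \<le> n" for i e
    using telescope[of e "n - k" i] that by (simp add: F(2) algebra_simps)
  define A where "A = mat n n (\<lambda>(i, j). F i (r (Suc j) + (n - Suc j)))"
  \<comment> \<open>The left neighbour of column \<open>j\<close> has exponent
    \<open>t = Suc (r j) + (n - Suc j)\<close>. Its multiple is subtracted exactly when the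
    unrolling from column \<open>j\<close> can reach it, \<open>t + k \<le> n\<close>; the power of
    \<alpha> is the difference of the two exponents.\<close>
  define N where "N = mat n n (\<lambda>(i, j). if i = j then 1 else
    if Suc i = j \<and> r (Suc j) + k < Suc j \<and> r j + k \<le> j then - (\<alpha> ^ (Suc (r j) - r (Suc j))) else 0)"
  have AN: "A \<in> carrier_mat n n" "N \<in> carrier_mat n n"
    by (simp_all add: A_def N_def)
  have "det N = prod_list (diag_mat N)"
    by (rule det_upper_triangular[OF _ AN(2)]) (auto simp: N_def upper_triangular_def)
  also have "\<dots> = 1"
    by (simp add: diag_mat_def N_def prod.list_conv_set_nth)
  finally have "det A = det (A * N)"
    by (simp add: det_mult[OF AN])
  also have "A * N = mat n n (\<lambda>(i, j). \<Sum>s\<in>S j. \<alpha> ^ (s - r (Suc j)) * F' i (s + (n - Suc j)))" (is "_ = ?B")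
  proof (rule eq_matI)
    fix i j assume "i < dim_row ?B" "j < dim_col ?B"
    then have ij: "i < n" "j < n" by auto
    let ?e = "r (Suc j) + (n - Suc j)"
    let ?c = "if 1 \<le> j \<and> r (Suc j) + k < Suc j \<and> r j + k \<le> j
      then \<alpha> ^ (Suc (r j) - r (Suc j)) * F i (Suc (r j) + (n - Suc j)) else 0"
    have "(A * N) $$ (i, j) = (\<Sum>l<n. A $$ (i, l) * N $$ (l, j))"
      using ij AN by (simp add: scalar_prod_def atLeast0LessThan)
    also have "\<dots> = (\<Sum>l<n. (if l = j then F i ?e else 0) - (if l = j - 1 then ?c else 0))"
      using ij by (intro sum.cong) (auto simp: A_def N_def Suc_diff_Suc)
    also have "\<dots> = F i ?e - ?c"
      using ij by (simp add: sum_subtractf less_imp_diff_less)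
    also have "\<dots> = (\<Sum>s\<in>S j. \<alpha> ^ (s - r (Suc j)) * F' i (s + (n - Suc j)))"
    proof -
      have shift: "(\<Sum>s\<in>{?e..<t + (n - Suc j)}. \<alpha> ^ (s - ?e) * F' i s)
          = (\<Sum>s\<in>{r (Suc j)..<t}. \<alpha> ^ (s - r (Suc j)) * F' i (s + (n - Suc j)))" for t
        by (subst sum.shift_bounds_nat_ivl) simp
      \<comment> \<open>The row cannot grow; its growth is limited by the row above; its growth is
        limited by the flag.\<close>
      consider "Suc j \<le> r (Suc j) + k" | "r (Suc j) + k < Suc j" "r j + k \<le> j" | "r (Suc j) + k < Suc j" "j < r j + k"
        by linarith
      then show ?thesis
      proof cases
        case 1
        then have "S j = {r (Suc j)}"
          using r'[of j] by (auto simp: S_def)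
        then show ?thesis
          using 1 ij by (simp add: F(2))
      next
        case 2
        then have j: "1 \<le> j" using k by simp
        then have "S j = {r (Suc j)..<Suc (r j)}"
          using 2 by (auto simp: S_def)
        moreover have "F i ?e - \<alpha> ^ (Suc (r j) + (n - Suc j) - ?e) * F i (Suc (r j) + (n - Suc j))
            = (\<Sum>s\<in>{?e..<Suc (r j) + (n - Suc j)}. \<alpha> ^ (s - ?e) * F' i s)"
          using 2 ij r'[OF j] by (intro telescope) auto
        ultimately show ?thesis
          using 2 j unfolding shift by simp
      next
        case 3
        have j: "1 \<le> j" using 3 k by (cases j) auto
        then have "S j = {r (Suc j)..<Suc (Suc j - k)}"
          using 3 k by (auto simp: S_def)
        moreover have "Suc (n - k) = Suc (Suc j - k) + (n - Suc j)"
          using 3 ij by simp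
        then have "F i ?e = (\<Sum>s\<in>{?e..<Suc (Suc j - k) + (n - Suc j)}. \<alpha> ^ (s - ?e) * F' i s)"
          using 3 ij telescope'[of ?e i] by simp
        ultimately show ?thesis
          using 3 unfolding shift by simp
      qed
    qed
    finally show "(A * N) $$ (i, j) = ?B $$ (i, j)"
      using ij by simp
  qed (simp_all add: A_def N_def)
  also have "det ?B = (\<Sum>q\<in>?Q. (\<Prod>j<n. \<alpha> ^ (q (Suc j) - r (Suc j))) * shape_det n F' q)"
    by (rule det_columns_sum) (rule finS)
  also have "\<dots> = (\<Sum>q | shape n q \<and> strip (int k) r q.
     \<alpha> ^ card (boxes q - boxes r) * shape_det n F' q)"
    unfolding Q_shape by (rule sum.cong) (auto simp: card_boxes_diff power_sum)
  finally show ?thesis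
    unfolding A_def .
qed


section \<open>Removing an entry from a tableau\<close>

lemma shape_antimono:
  assumes "shape n p" "1 \<le> i" "i \<le> i'"
  shows "p i' \<le> p i"
  using assms(3)
proof (induction rule: dec_induct)
  case (step k)
  then have "p (Suc k) \<le> p k"
    using assms by (simp add: shape_def)
  then show ?case
    using step by simp
qed simp

lemma shape_le_iff_boxes: "p 0 = 0 \<Longrightarrow> (\<forall>i. p i \<le> q i) \<longleftrightarrow> boxes p \<subseteq> boxes q"
proof
  assume 0: "p 0 = 0" and sub: "boxes p \<subseteq> boxes q"
  show "\<forall>i. p i \<le> q i"
  proof
    fix i
    have "(i, p i) \<in> boxes q" if "i \<noteq> 0" "p i \<noteq> 0"
      by (rule subsetD[OF sub]) (use that in \<open>simp add: boxes_def\<close>)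
    then show "p i \<le> q i"
      using 0 by (cases "i = 0 \<or> p i = 0") (auto simp: boxes_def)
  qed
qed (auto simp: boxes_def intro: order_trans)

definition row_lengths :: "(nat \<times> nat) set \<Rightarrow> nat \<Rightarrow> nat" where
  "row_lengths B i = card {j. (i, j) \<in> B}"

lemma row_lengths_boxes: "r 0 = 0 \<Longrightarrow> row_lengths (boxes r) = r"
proof
  fix i assume "r 0 = 0"
  moreover have "{j. (i, j) \<in> boxes r} = (if i = 0 then {} else {1..r i})"
    by (auto simp: boxes_def)
  ultimately show "row_lengths (boxes r) i = r i"
    by (simp add: row_lengths_def)
qed

lemma boxes_row_lengths:
  assumes B: "B \<subseteq> boxes q" and rows: "\<And>i j k. (i, j) \<in> B \<Longrightarrow> 1 \<le> k \<Longrightarrow> k \<le> j \<Longrightarrow> (i, k) \<in> B"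
  shows "boxes (row_lengths B) = B"
proof -
  have "(i, j) \<in> B \<longleftrightarrow> (i, j) \<in> boxes (row_lengths B)" for i j
  proof -
    have "{j. (i, j) \<in> B} = {1..card {j. (i, j) \<in> B}}"
    proof (rule downset_eq_atLeastAtMost)
      show "finite {j. (i, j) \<in> B}"
        by (rule finite_subset[of _ "{..q i}"]) (use B in \<open>auto simp: boxes_def\<close>)
    qed (use B rows in \<open>auto simp: boxes_def\<close>)
    then have "j \<in> {j. (i, j) \<in> B} \<longleftrightarrow> j \<in> {1..row_lengths B i}"
      unfolding row_lengths_def by (rule arg_cong)
    then show ?thesis
      using B by (auto simp: boxes_def)
  qed
  then show ?thesis
    by auto
qed

text \<open>The sign of the left entry selects the rule, so one relation serves both halves of a
  dual hook tableau. Related entries always have the same sign; likewise for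
  \<open>col_rel\<close>.\<close>

definition row_rel :: "int \<Rightarrow> int \<Rightarrow> bool" where
  "row_rel v w \<longleftrightarrow> (if v \<le> 0 then w < v else v \<le> w)"

definition col_rel :: "int \<Rightarrow> int \<Rightarrow> bool" where
  "col_rel v w \<longleftrightarrow> (if v \<le> 0 then w \<le> v else v < w)"

text \<open>The bounds by row and column lengths would change when boxes are removed;
  \<open>flag\<close> depends only on the box. The value set \<open>V\<close> is what the induction
  runs over.\<close>

definition fillings :: "int set \<Rightarrow> (nat \<Rightarrow> nat) \<Rightarrow> (nat \<Rightarrow> nat) \<Rightarrow> (nat \<times> nat \<Rightarrow> int) set" where
  "fillings V q p = {T \<in> extensional (boxes q - boxes p).
     (\<forall>b\<in>boxes q - boxes p. T b \<in> V \<and> flag (T b) b) \<and>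
     (\<forall>i j j'. (i, j) \<in> boxes q - boxes p \<and> (i, j') \<in> boxes q - boxes p \<and> j < j' \<longrightarrow>
        row_rel (T (i, j)) (T (i, j'))) \<and>
     (\<forall>i i' j. (i, j) \<in> boxes q - boxes p \<and> (i', j) \<in> boxes q - boxes p \<and> i < i' \<longrightarrow>
        col_rel (T (i, j)) (T (i', j)))}"

lemma fillingsD:
  assumes "T \<in> fillings V q p"
  shows "T \<in> extensional (boxes q - boxes p)"
    and "b \<in> boxes q - boxes p \<Longrightarrow> T b \<in> V"
    and "b \<in> boxes q - boxes p \<Longrightarrow> flag (T b) b"
    and "(i, j) \<in> boxes q - boxes p \<Longrightarrow> (i, j') \<in> boxes q - boxes p \<Longrightarrow> j < j' \<Longrightarrow>
      row_rel (T (i, j)) (T (i, j'))"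
    and "(i, j) \<in> boxes q - boxes p \<Longrightarrow> (i', j) \<in> boxes q - boxes p \<Longrightarrow> i < i' \<Longrightarrow>
      col_rel (T (i, j)) (T (i', j))"
  using assms by (simp_all add: fillings_def)

lemma finite_fillings:
  assumes "finite V" "shape n q"
  shows "finite (fillings V q p)"
proof (rule finite_subset)
  show "fillings V q p \<subseteq> PiE (boxes q - boxes p) (\<lambda>_. V)"
    by (auto simp: fillings_def PiE_def Pi_def)
  show "finite (PiE (boxes q - boxes p) (\<lambda>_. V))"
    using assms by (intro finite_PiE finite_boxes_diff)
qed

definition weight :: "(int \<Rightarrow> 'a::comm_ring_1) \<Rightarrow> int set \<Rightarrow> (nat \<Rightarrow> nat) \<Rightarrow> (nat \<Rightarrow> nat) \<Rightarrow> 'a" where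
  "weight a V q p = (\<Sum>T\<in>fillings V q p. \<Prod>b\<in>boxes q - boxes p. a (T b))"

lemma weight_empty:
  assumes "shape n q" "shape n p" "\<forall>i. p i \<le> q i"
  shows "weight a {} q p = (if q = p then 1 else 0)"
proof (cases "q = p")
  case True
  then have "fillings {} q p = {\<lambda>_. undefined}"
    by (auto simp: fillings_def)
  then show ?thesis
    using True by (simp add: weight_def)
next
  case False
  have "boxes q - boxes p \<noteq> {}"
  proof
    assume "boxes q - boxes p = {}"
    then have "\<forall>i. q i \<le> p i"
      using assms by (subst shape_le_iff_boxes) (auto simp: shape_def)
    then show False
      using assms False by (auto simp: fun_eq_iff intro: antisym)
  qed
  then have "fillings {} q p = {}"
    by (auto simp: fillings_def)
  then show ?thesis
    using False by (simp add: weight_def)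
qed

text \<open>
  Positive entries are removed from the largest one downwards, the others from the smallest one
  upwards.
\<close>

definition final_entry :: "int \<Rightarrow> int set \<Rightarrow> bool" where
  "final_entry v V \<longleftrightarrow> (\<forall>w\<in>V. (v \<le> 0 \<and> w \<le> 0 \<longrightarrow> v < w) \<and> (0 < v \<and> 0 < w \<longrightarrow> w < v))"

lemma final_entry_notin: "final_entry v V \<Longrightarrow> v \<notin> V"
  by (auto simp: final_entry_def)

lemma not_flag_diagonal: "\<not> flag v (i, i)"
  by (simp add: flag_def)

text \<open>By \<open>final_entry\<close>, no other entry may stand to the right of \<open>v\<close>
  or below it. Hence the boxes without \<open>v\<close> are closed under moving left or up and form
  a shape. The boxes with \<open>v\<close> form a strip because \<open>row_rel v v\<close> fails for
  \<open>v \<le> 0\<close> and \<open>col_rel v v\<close> fails for \<open>v > 0\<close>.\<close>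

lemma
  assumes q: "shape n q" and p: "shape n p" and pq: "\<forall>i. p i \<le> q i"
    and v: "final_entry v V" and T: "T \<in> fillings (insert v V) q p"
  defines "B \<equiv> {b \<in> boxes q. b \<in> boxes p \<or> T b \<noteq> v}"
  shows boxes_row_lengths_filling: "boxes (row_lengths B) = B"
    and shape_row_lengths_filling: "shape n (row_lengths B)"
    and row_lengths_filling_ge: "\<forall>i. p i \<le> row_lengths B i"
    and strip_row_lengths_filling: "strip v (row_lengths B) q"
    and restrict_mem_fillings: "restrict T (B - boxes p) \<in> fillings V (row_lengths B) p"
proof -
  have final: "\<not> row_rel v w" "\<not> col_rel v w" if "w \<in> insert v V" "w \<noteq> v" for w
    using v that by (auto simp: final_entry_def row_rel_def col_rel_def)
  have B_iff: "b \<in> B \<longleftrightarrow> b \<in> boxes q \<and> (b \<in> boxes p \<or> T b \<noteq> v)" for b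
    by (simp add: B_def)
  have rows: "(i, k) \<in> B" if "(i, j) \<in> B" "1 \<le> k" "k \<le> j" for i j k
  proof (rule ccontr)
    assume k: "(i, k) \<notin> B"
    have "(i, k) \<in> boxes q"
      using that by (auto simp: B_iff boxes_def)
    with k have "(i, k) \<in> boxes q - boxes p" "T (i, k) = v"
      by (auto simp: B_iff)
    moreover from this have "(i, j) \<in> boxes q - boxes p"
      using that by (auto simp: B_iff boxes_def)
    moreover have "k < j"
      using that k by (cases "k = j") auto
    moreover have "T (i, j) \<noteq> v"
      using that(1) \<open>(i, j) \<in> boxes q - boxes p\<close> by (auto simp: B_iff)
    ultimately show False
      using fillingsD(4)[OF T, of i k j] fillingsD(2)[OF T, of "(i, j)"] final(1)[of "T (i, j)"] by simp
  qed
  have cols: "(k, j) \<in> B" if "(i, j) \<in> B" "1 \<le> k" "k \<le> i" for i j k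
  proof (rule ccontr)
    assume k: "(k, j) \<notin> B"
    have "(k, j) \<in> boxes q"
      using that shape_antimono[OF q that(2,3)] by (auto simp: B_iff boxes_def)
    with k have "(k, j) \<in> boxes q - boxes p" "T (k, j) = v"
      by (auto simp: B_iff)
    moreover from this have "(i, j) \<in> boxes q - boxes p"
      using that shape_antimono[OF p that(2,3)] by (auto simp: B_iff boxes_def)
    moreover have "k < i"
      using that k by (cases "k = i") auto
    moreover have "T (i, j) \<noteq> v"
      using that(1) \<open>(i, j) \<in> boxes q - boxes p\<close> by (auto simp: B_iff)
    ultimately show False
      using fillingsD(5)[OF T, of k j i] fillingsD(2)[OF T, of "(i, j)"] final(2)[of "T (i, j)"] by simp
  qed
  let ?r = "row_lengths B"
  show boxes: "boxes ?r = B"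
  proof (rule boxes_row_lengths)
    show "B \<subseteq> boxes q"
      by (auto simp: B_iff)
  qed (fact rows)
  have mem: "(i, j) \<in> B \<longleftrightarrow> 1 \<le> i \<and> 1 \<le> j \<and> j \<le> ?r i" for i j
    using arg_cong[OF boxes, of "\<lambda>S. (i, j) \<in> S"] by (simp add: boxes_def)
  have r0: "?r i = 0" if "i = 0 \<or> n < i" for i
  proof -
    have "(i, j) \<notin> boxes q" for j
      using that q by (auto simp: boxes_def shape_def)
    then show ?thesis
      by (simp add: row_lengths_def B_iff)
  qed
  have rq: "\<forall>i. ?r i \<le> q i"
    using r0[of 0] by (subst shape_le_iff_boxes) (auto simp: boxes B_iff)
  show shape: "shape n ?r"
    unfolding shape_def
  proof (intro conjI allI impI)
    fix i :: nat assume i: "1 \<le> i"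
    show "?r (Suc i) \<le> ?r i"
    proof (cases "?r (Suc i) = 0")
      case False
      then have "(Suc i, ?r (Suc i)) \<in> B"
        by (simp add: mem)
      then have "(i, ?r (Suc i)) \<in> B"
        using i by (rule cols) simp
      then show ?thesis
        by (simp add: mem)
    qed simp
  qed (use r0 in auto)
  show pr: "\<forall>i. p i \<le> ?r i"
  proof (subst shape_le_iff_boxes)
    have "boxes p \<subseteq> boxes q"
      using p pq by (subst shape_le_iff_boxes[symmetric]) (auto simp: shape_def)
    then show "boxes p \<subseteq> boxes ?r"
      by (auto simp: boxes B_iff)
  qed (use p in \<open>auto simp: shape_def\<close>)
  have new: "b \<in> boxes q - boxes p" "T b = v" if "b \<in> boxes q - B" for b
    using that by (auto simp: B_iff)
  have "flag v b" if "b \<in> boxes q - boxes ?r" for b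
    using fillingsD(3)[OF T, of b] new[of b] that by (simp add: boxes)
  moreover have "q i \<le> Suc (?r i)" if "v \<le> 0" for i
  proof (rule ccontr)
    assume less: "\<not> q i \<le> Suc (?r i)"
    have "i \<noteq> 0"
      using less q by (cases i) (auto simp: shape_def)
    then have "(i, Suc (?r i)) \<in> boxes q - B" "(i, Suc (Suc (?r i))) \<in> boxes q - B"
      using less by (auto simp: mem) (auto simp: boxes_def)
    from new[OF this(1)] new[OF this(2)] show False
      using fillingsD(4)[OF T, of i "Suc (?r i)" "Suc (Suc (?r i))"] that by (simp add: row_rel_def)
  qed
  \<comment> \<open>Otherwise \<open>v\<close> would occupy two boxes of column
    \<open>Suc (?r i)\<close>.\<close>
  moreover have "q (Suc i) \<le> ?r i" if "0 < v" "1 \<le> i" for i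
  proof (rule ccontr)
    assume less: "\<not> q (Suc i) \<le> ?r i"
    have "q (Suc i) \<le> q i" "?r (Suc i) \<le> ?r i"
      using q shape that by (simp_all add: shape_def)
    then have "(i, Suc (?r i)) \<in> boxes q - B" "(Suc i, Suc (?r i)) \<in> boxes q - B"
      using less that by (auto simp: mem) (auto simp: boxes_def)
    from new[OF this(1)] new[OF this(2)] show False
      using fillingsD(5)[OF T, of i "Suc (?r i)" "Suc i"] that by (simp add: col_rel_def)
  qed
  ultimately show "strip v ?r q"
    using rq by (simp add: strip_def)
  have sub: "B - boxes p \<subseteq> boxes q - boxes p"
    by (auto simp: B_iff)
  have "T b \<in> V" if "b \<in> B - boxes p" for b
    using fillingsD(2)[OF T, of b] that by (auto simp: B_iff)
  then show "restrict T (B - boxes p) \<in> fillings V ?r p"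
    using subsetD[OF sub] fillingsD(3-5)[OF T] unfolding fillings_def boxes by simp
qed

text \<open>Within one sign, \<open>final_entry\<close> puts \<open>v\<close> in the right order
  after the entries of \<open>T\<close>. Entries of opposite sign could meet in a row or column only
  across the diagonal, and then the skew shape would contain a diagonal box, which
  \<open>flag\<close> excludes.\<close>

lemma extend_mem_fillings:
  assumes q: "shape n q" and p: "shape n p" and r: "shape n r"
    and strip: "strip v r q" and v: "final_entry v V" and T: "T \<in> fillings V r p"
  shows "(\<lambda>b\<in>boxes q - boxes p. if b \<in> boxes r then T b else v) \<in> fillings (insert v V) q p"
    (is "restrict ?T _ \<in> _")
proof -
  let ?S = "boxes q - boxes p"
  have flag_new: "\<And>b. b \<in> boxes q - boxes r \<Longrightarrow> flag v b"
    using strip by (auto simp: strip_def)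
  have flag: "flag (?T b) b" if "b \<in> ?S" for b
    using that flag_new[of b] fillingsD(3)[OF T, of b] by auto
  have nodiag: "(i, i) \<notin> ?S" for i
    using flag[of "(i, i)"] not_flag_diagonal by blast
  have final: "(v \<le> 0 \<and> w \<le> 0 \<longrightarrow> v < w) \<and> (0 < v \<and> 0 < w \<longrightarrow> w < v)" if "w \<in> V" for w
    using v that by (auto simp: final_entry_def)
  have V: "?T b \<in> insert v V" if "b \<in> ?S" for b
    using that fillingsD(2)[OF T, of b] by auto
  have row: "row_rel (?T (i, j)) (?T (i, j'))" if S: "(i, j) \<in> ?S" "(i, j') \<in> ?S" and less: "j < j'" for i j j'
  proof -
    have i: "1 \<le> i" "1 \<le> j" "j' \<le> q i" "p i < j"
      using S by (auto simp: boxes_def)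
    consider "(i, j) \<in> boxes r" "(i, j') \<in> boxes r" | "(i, j) \<in> boxes r" "(i, j') \<notin> boxes r"
      | "(i, j) \<notin> boxes r" "(i, j') \<notin> boxes r"
      using less i by (auto simp: boxes_def)
    then show ?thesis
    proof cases
      case 1
      then show ?thesis
        using S less fillingsD(4)[OF T, of i j j'] by simp
    next
      case 2
      let ?w = "T (i, j)"
      have "?w \<in> V" "flag ?w (i, j)" "flag v (i, j')"
        using 2 S fillingsD(2,3)[OF T, of "(i, j)"] flag_new by auto
      moreover have "\<not> (j < i \<and> i < j')"
        using nodiag[of i] i by (auto simp: boxes_def)
      ultimately show ?thesis
        using 2 final[of ?w] less by (auto simp: row_rel_def flag_def split: if_splits)
    next
      case 3
      \<comment> \<open>Two new boxes in one row occur only for positive \<open>v\<close>, for which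
        repetition along a row is allowed.\<close>
      then have "\<not> v \<le> 0"
        using strip less i by (auto simp: strip_def boxes_def dest!: spec[of _ i])
      then show ?thesis
        using 3 by (simp add: row_rel_def)
    qed
  qed
  have col: "col_rel (?T (i, j)) (?T (i', j))" if S: "(i, j) \<in> ?S" "(i', j) \<in> ?S" and less: "i < i'" for i i' j
  proof -
    have i: "1 \<le> i" "1 \<le> j" "j \<le> q i'" "p i < j"
      using S by (auto simp: boxes_def)
    have "r i' \<le> r i"
      using shape_antimono[OF r, of i i'] i less by simp
    then consider "(i, j) \<in> boxes r" "(i', j) \<in> boxes r" | "(i, j) \<in> boxes r" "(i', j) \<notin> boxes r"
      | "(i, j) \<notin> boxes r" "(i', j) \<notin> boxes r"
      using less i by (auto simp: boxes_def)
    then show ?thesis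
    proof cases
      case 1
      then show ?thesis
        using S less fillingsD(5)[OF T, of i j i'] by simp
    next
      case 2
      let ?w = "T (i, j)"
      have "?w \<in> V" "flag ?w (i, j)" "flag v (i', j)"
        using 2 S fillingsD(2,3)[OF T, of "(i, j)"] flag_new by auto
      moreover have "\<not> (i < j \<and> j < i')"
        using nodiag[of j] i shape_antimono[OF q, of j i'] shape_antimono[OF p, of i j]
        by (auto simp: boxes_def)
      ultimately show ?thesis
        using 2 final[of ?w] less by (auto simp: col_rel_def flag_def split: if_splits)
    next
      case 3
      have "q i' \<le> q (Suc i)"
        using shape_antimono[OF q, of "Suc i" i'] less by simp
      moreover have "r i < j"
        using 3 i by (auto simp: boxes_def)
      ultimately have "v \<le> 0"
        using strip i by (auto simp: strip_def split: if_splits dest!: spec[of _ i])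
      then show ?thesis
        using 3 by (simp add: col_rel_def)
    qed
  qed
  show ?thesis
    unfolding fillings_def using V flag row col by simp
qed

text \<open>The fillings are sorted by the shape \<open>r\<close> left after deleting the boxes
  filled with \<open>v\<close>; these boxes account for the power of \<open>a v\<close>.\<close>

lemma weight_insert:
  assumes q: "shape n q" and p: "shape n p" and pq: "\<forall>i. p i \<le> q i"
    and v: "final_entry v V" and V: "finite V"
  shows "weight a (insert v V) q p = (\<Sum>r | shape n r \<and> (\<forall>i. p i \<le> r i) \<and> strip v r q.
    a v ^ card (boxes q - boxes r) * weight a V r p)"
proof -
  let ?S = "boxes q - boxes p"
  let ?R = "{r. shape n r \<and> (\<forall>i. p i \<le> r i) \<and> strip v r q}"
  let ?B = "\<lambda>T. {b \<in> boxes q. b \<in> boxes p \<or> T b \<noteq> v}"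
  let ?h = "\<lambda>(r, T). a v ^ card (boxes q - boxes r) * (\<Prod>b\<in>boxes r - boxes p. a (T b))"
  obtain M where M: "\<And>i. q i \<le> M"
    using shape_bounded[OF q] by blast
  have "finite ?R"
    by (rule finite_subset[OF _ finite_bounded_shapes[of n M]])
      (auto simp: strip_def intro: order_trans[OF _ M])
  moreover have "finite (fillings V r p)" if "r \<in> ?R" for r
    using that V by (auto intro: finite_fillings)
  ultimately have "(\<Sum>r\<in>?R. a v ^ card (boxes q - boxes r) * weight a V r p)
      = (\<Sum>x\<in>(SIGMA r:?R. fillings V r p). ?h x)"
    by (simp add: weight_def sum_distrib_left sum.Sigma)
  also have "\<dots> = weight a (insert v V) q p"
    unfolding weight_def
  proof (rule sum.reindex_bij_witness[symmetric, of _
        "\<lambda>(r, T). \<lambda>b\<in>?S. if b \<in> boxes r then T b else v"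
        "\<lambda>T. (row_lengths (?B T), restrict T (?B T - boxes p))"])
    fix T assume T: "T \<in> fillings (insert v V) q p"
    note filling = boxes_row_lengths_filling[OF q p pq v T] shape_row_lengths_filling[OF q p pq v T]
      row_lengths_filling_ge[OF q p pq v T] strip_row_lengths_filling[OF q p pq v T]
      restrict_mem_fillings[OF q p pq v T]
    show "(case (row_lengths (?B T), restrict T (?B T - boxes p)) of
        (r, T) \<Rightarrow> \<lambda>b\<in>?S. if b \<in> boxes r then T b else v) = T"
      using fillingsD(1)[OF T] by (auto simp: filling(1) fun_eq_iff extensional_def restrict_def)
    show "(row_lengths (?B T), restrict T (?B T - boxes p)) \<in> (SIGMA r:?R. fillings V r p)"
      using filling by blast
    have "(\<Prod>b\<in>?S. a (T b)) = (\<Prod>b\<in>boxes q - ?B T. a (T b)) * (\<Prod>b\<in>?B T - boxes p. a (T b))"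
      by (subst prod.union_disjoint[symmetric])
        (use finite_boxes_diff[OF q, of p] in \<open>auto intro!: prod.cong elim!: finite_subset[rotated]\<close>)
    also have "(\<Prod>b\<in>boxes q - ?B T. a (T b)) = a v ^ card (boxes q - ?B T)"
      by simp
    also have "(\<Prod>b\<in>?B T - boxes p. a (T b)) = (\<Prod>b\<in>?B T - boxes p. a (restrict T (?B T - boxes p) b))"
      by (rule prod.cong) auto
    finally show "?h (row_lengths (?B T), restrict T (?B T - boxes p)) = (\<Prod>b\<in>?S. a (T b))"
      by (simp only: prod.case filling(1))
  next
    fix x assume "x \<in> (SIGMA r:?R. fillings V r p)"
    then obtain r T where x: "x = (r, T)" and r: "shape n r" "\<forall>i. p i \<le> r i" "strip v r q"
      and T: "T \<in> fillings V r p"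
      by auto
    let ?T = "\<lambda>b\<in>?S. if b \<in> boxes r then T b else v"
    show "(case x of (r, T) \<Rightarrow> \<lambda>b\<in>?S. if b \<in> boxes r then T b else v) \<in> fillings (insert v V) q p"
      unfolding x prod.case by (rule extend_mem_fillings[OF q p r(1,3) v T])
    have sub: "boxes p \<subseteq> boxes r" "boxes r \<subseteq> boxes q"
      using p r by (auto simp: shape_le_iff_boxes[symmetric] shape_def strip_def)
    have "T b \<noteq> v" if "b \<in> boxes r - boxes p" for b
      using fillingsD(2)[OF T that] final_entry_notin[OF v] by auto
    then have B: "?B ?T = boxes r"
      using sub by auto
    have "row_lengths (boxes r) = r"
      using r(1) by (intro row_lengths_boxes) (simp add: shape_def)
    moreover have "restrict ?T (boxes r - boxes p) = T"
      using fillingsD(1)[OF T] sub by (auto simp: fun_eq_iff extensional_def restrict_def)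
    ultimately show "(\<lambda>T. (row_lengths (?B T), restrict T (?B T - boxes p)))
        (case x of (r, T) \<Rightarrow> \<lambda>b\<in>?S. if b \<in> boxes r then T b else v) = x"
      unfolding x prod.case B by simp
  qed
  finally show ?thesis ..
qed


section \<open>Expansion in finitely many variables\<close>

lemma finite_strips: "finite {q. shape n q \<and> strip v r q}"
proof -
  obtain M where M: "\<And>i. i \<le> n \<Longrightarrow> r i \<le> M"
    by (rule that[of "Max (r ` {..n})"]) simp
  have "q i \<le> Suc M" if q: "shape n q" and strip: "strip v r q" for q i
  proof (cases "i = 0 \<or> n < i")
    case True
    then show ?thesis
      using q by (auto simp: shape_def)
  next
    case False
    then obtain k where k: "i = Suc k" "Suc k \<le> n"
      by (cases i) auto
    show ?thesis
    proof (cases "v \<le> 0")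
      case True
      then have "q i \<le> Suc (r i)"
        using strip by (simp add: strip_def)
      then show ?thesis
        using M[of i] k by simp
    next
      case False
      show ?thesis
      \<comment> \<open>The first row has no row above to bound it, but for \<open>v > 0\<close> the
        flag admits no box there.\<close>
      proof (cases "k = 0 \<and> r 1 < q 1")
        case True
        then have "flag v (1, q 1)"
          using strip by (auto simp: strip_def boxes_def)
        then show ?thesis
          using False True by (simp add: flag_def)
      next
        case k': False
        then have "q i \<le> r 1 \<or> 1 \<le> k \<and> q i \<le> r k"
          using strip False k by (cases "k = 0") (auto simp: strip_def)
        then show ?thesis
          using M[of 1] M[of k] k by auto
      qed
    qed
  qed
  then show ?thesis
    by (intro finite_subset[OF _ finite_bounded_shapes[of n "Suc M"]]) auto
qed

text \<open>There may be infinitely many shapes containing \<open>p\<close>, so a finite index set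
  is part of the notion; the vanishing of the weights outside it makes the sum independent of the
  choice.\<close>

definition expansion ::
  "(int \<Rightarrow> 'a::comm_ring_1) \<Rightarrow> nat \<Rightarrow> (nat \<Rightarrow> nat) \<Rightarrow> int set \<Rightarrow> 'a mfps \<Rightarrow> (nat \<Rightarrow> nat \<Rightarrow> 'a mfps) \<Rightarrow> bool" where
  "expansion a n p V D F \<longleftrightarrow> (\<exists>A. finite A \<and> (\<forall>q\<in>A. shape n q \<and> (\<forall>i. p i \<le> q i)) \<and>
     (\<forall>q. shape n q \<and> (\<forall>i. p i \<le> q i) \<and> q \<notin> A \<longrightarrow> weight a V q p = 0) \<and>
     D = (\<Sum>q\<in>A. Const (weight a V q p) * shape_det n F q))"

lemma expansion_empty:
  assumes "shape n p"
  shows "expansion a n p {} (shape_det n F p) F"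
  unfolding expansion_def
  by (rule exI[of _ "{p}"]) (use assms in \<open>auto simp: weight_empty\<close>)

text \<open>Each determinant is replaced by its strip expansion and the sums are exchanged; by
  \<open>weight_insert\<close> the inner sums are the new weights.\<close>

lemma expansion_insert:
  assumes p: "shape n p" and V: "finite V" and v: "final_entry v V"
    and exp: "expansion a n p V D F"
    and step: "\<And>r. shape n r \<Longrightarrow> shape_det n F r = (\<Sum>q | shape n q \<and> strip v r q.
      Const (a v) ^ card (boxes q - boxes r) * shape_det n F' q)"
  shows "expansion a n p (insert v V) D F'"
proof -
  obtain A where A: "finite A" "\<And>q. q \<in> A \<Longrightarrow> shape n q" "\<And>q i. q \<in> A \<Longrightarrow> p i \<le> q i"
    and A0: "\<And>q. shape n q \<Longrightarrow> \<forall>i. p i \<le> q i \<Longrightarrow> q \<notin> A \<Longrightarrow> weight a V q p = 0"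
    and D: "D = (\<Sum>q\<in>A. Const (weight a V q p) * shape_det n F q)"
    using exp unfolding expansion_def by blast
  define A' where "A' = (\<Union>r\<in>A. {q. shape n q \<and> strip v r q})"
  let ?c = "\<lambda>r q. a v ^ card (boxes q - boxes r) * weight a V r p"
  have finA': "finite A'"
    using A(1) finite_strips by (auto simp: A'_def)
  have A': "shape n q" "\<forall>i. p i \<le> q i" if "q \<in> A'" for q
    using that A(3) by (auto simp: A'_def strip_def intro: order_trans)
  have weight: "weight a (insert v V) q p = (\<Sum>r | r \<in> A \<and> strip v r q. ?c r q)"
    if q: "shape n q" "\<forall>i. p i \<le> q i" for q
    unfolding weight_insert[OF q(1) p q(2) v V]
  proof (rule sum.mono_neutral_right)
    obtain M where M: "\<And>i. q i \<le> M"
      using shape_bounded[OF q(1)] by blast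
    show "finite {r. shape n r \<and> (\<forall>i. p i \<le> r i) \<and> strip v r q}"
      by (rule finite_subset[OF _ finite_bounded_shapes[of n M]])
        (auto simp: strip_def intro: order_trans[OF _ M])
    show "\<forall>r\<in>{r. shape n r \<and> (\<forall>i. p i \<le> r i) \<and> strip v r q} - {r. r \<in> A \<and> strip v r q}. ?c r q = 0"
    proof
      fix r assume "r \<in> {r. shape n r \<and> (\<forall>i. p i \<le> r i) \<and> strip v r q} - {r. r \<in> A \<and> strip v r q}"
      then have "weight a V r p = 0"
        by (intro A0) auto
      then show "?c r q = 0"
        by simp
    qed
  qed (use A in auto)
  have "D = (\<Sum>r\<in>A. \<Sum>q | q \<in> A' \<and> strip v r q. Const (?c r q) * shape_det n F' q)"
    unfolding D
  proof (rule sum.cong[OF refl])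
    fix r assume r: "r \<in> A"
    have "{q. shape n q \<and> strip v r q} = {q. q \<in> A' \<and> strip v r q}"
      using r A'(1) by (auto simp: A'_def)
    then show "Const (weight a V r p) * shape_det n F r
        = (\<Sum>q | q \<in> A' \<and> strip v r q. Const (?c r q) * shape_det n F' q)"
      by (simp add: step[OF A(2)[OF r]] sum_distrib_left Const_mult Const_power mult_ac)
  qed
  also have "\<dots> = (\<Sum>q\<in>A'. \<Sum>r | r \<in> A \<and> strip v r q. Const (?c r q) * shape_det n F' q)"
    by (rule sum.swap_restrict[OF A(1) finA'])
  also have "\<dots> = (\<Sum>q\<in>A'. Const (weight a (insert v V) q p) * shape_det n F' q)"
    by (rule sum.cong[OF refl]) (simp add: weight A' Const_sum sum_distrib_right)
  finally have D': "D = (\<Sum>q\<in>A'. Const (weight a (insert v V) q p) * shape_det n F' q)" .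
  have zero: "weight a (insert v V) q p = 0"
    if q: "shape n q" "\<forall>i. p i \<le> q i" "q \<notin> A'" for q
  proof -
    have none: "{r. r \<in> A \<and> strip v r q} = {}"
      using q by (auto simp: A'_def)
    show ?thesis
      unfolding weight[OF q(1,2)] none by simp
  qed
  show ?thesis
    unfolding expansion_def by (intro exI[of _ A'] conjI ballI allI impI finA' D') (use A' zero in auto)
qed

section \<open>Switching on one parameter\<close>

abbreviation hook_values :: "(int \<Rightarrow> 'a::comm_ring_1) \<Rightarrow> nat \<Rightarrow> nat \<Rightarrow> nat \<Rightarrow> nat \<Rightarrow> nat \<Rightarrow> 'a mfps" where
  "hook_values a K L n i e \<equiv> subst_var i (hook_basis a K L n e)"

text \<open>The product of \<open>K\<close> geometric series is \<open>1 - c X\<close> times that of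
  \<open>Suc K\<close>, with \<open>c = a (- int K)\<close>. Both resulting terms belong to the new
  basis, hence at most one box per row; the minus sign is the origin of the signs in the
  theorem.\<close>

lemma hook_basis_Suc_left:
  assumes "n + K \<le> e"
  shows "hook_basis a K L n e
    = hook_basis a (Suc K) L n e - fps_const (a (- int K)) * hook_basis a (Suc K) L n (Suc e)"
proof -
  let ?c = "fps_const (a (- int K))"
  let ?G = "\<Prod>l<K. geometric (a (- int l))"
  have "min (e - n + 1) K = K" "min (e - n + 1) (Suc K) = Suc K" "min (Suc e - n + 1) (Suc K) = Suc K"
    using assms by auto
  then have "hook_basis a (Suc K) L n e - ?c * hook_basis a (Suc K) L n (Suc e)
      = fps_X ^ e * ?G * ((1 - ?c * fps_X) * geometric (a (- int K)))"
    using assms by (simp add: hook_basis_def algebra_simps)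
  also have "\<dots> = hook_basis a K L n e"
    using assms \<open>min (e - n + 1) K = K\<close> by (simp add: hook_basis_def linear_factor_geometric)
  finally show ?thesis ..
qed

lemma hook_basis_Suc_left_eq:
  assumes "e < n + K"
  shows "hook_basis a K L n e = hook_basis a (Suc K) L n e"
proof (cases "n \<le> e")
  case True
  then have "min (e - n + 1) K = min (e - n + 1) (Suc K)"
    using assms by auto
  then show ?thesis
    by (simp add: hook_basis_def)
qed (simp add: hook_basis_def)

text \<open>If \<open>P\<close> is the product of the first \<open>L\<close> factors, then
  \<open>P = P (1 - c X) + c X P\<close>. The last term stays in the old basis, so the relation can
  be iterated and a row may gain many boxes.\<close>

lemma hook_basis_Suc_right:
  assumes "e + Suc L < n"
  shows "hook_basis a K L n e
    = hook_basis a K (Suc L) n e + fps_const (a (int (Suc L))) * hook_basis a K L n (Suc e)"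
proof -
  have "min (n - 1 - e) L = L" "min (n - 1 - e) (Suc L) = Suc L" "min (n - 1 - Suc e) L = L"
    using assms by auto
  then show ?thesis
    using assms by (simp add: hook_basis_def algebra_simps)
qed

lemma hook_basis_Suc_right_eq:
  assumes "n \<le> e + Suc L"
  shows "hook_basis a K L n e = hook_basis a K (Suc L) n e"
proof -
  have "min (n - 1 - e) L = min (n - 1 - e) (Suc L)"
    using assms by auto
  then show ?thesis
    by (simp add: hook_basis_def)
qed

definition entries :: "nat \<Rightarrow> nat \<Rightarrow> int set" where
  "entries K L = {1..int L} \<union> (\<lambda>l. - int l) ` {..<K}"

text \<open>Attaches the sign to each nonpositive entry, that is, to each box above the
  diagonal.\<close>

definition signed :: "(int \<Rightarrow> 'a::comm_ring_1) \<Rightarrow> int \<Rightarrow> 'a" where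
  "signed a v = (if v \<le> 0 then - a v else a v)"

lemma finite_entries: "finite (entries K L)"
  by (simp add: entries_def)

lemma expansion_right_entries:
  assumes p: "shape n p"
  shows "expansion (signed a) n p (entries 0 L) (shape_det n (hook_values a 0 0 n) p) (hook_values a 0 L n)"
proof (induction L)
  case 0
  then show ?case
    using expansion_empty[OF p] by (simp add: entries_def)
next
  case (Suc L)
  have "expansion (signed a) n p (insert (int (Suc L)) (entries 0 L))
      (shape_det n (hook_values a 0 0 n) p) (hook_values a 0 (Suc L) n)"
  proof (rule expansion_insert[OF p finite_entries _ Suc])
    show "final_entry (int (Suc L)) (entries 0 L)"
      by (auto simp: final_entry_def entries_def)
    fix r assume r: "shape n r"
    show "shape_det n (hook_values a 0 L n) r = (\<Sum>q | shape n q \<and> strip (int (Suc L)) r q.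
        Const (signed a (int (Suc L))) ^ card (boxes q - boxes r) * shape_det n (hook_values a 0 (Suc L) n) q)"
    proof (rule horizontal_strip_expansion[OF r])
      fix i e
      show "hook_values a 0 L n i e = hook_values a 0 (Suc L) n i e
          + Const (signed a (int (Suc L))) * hook_values a 0 L n i (Suc e)" if "e + Suc L < n"
        by (subst hook_basis_Suc_right[OF that]) (simp add: signed_def divdiff_add divdiff_const_mult)
      show "hook_values a 0 L n i e = hook_values a 0 (Suc L) n i e" if "n \<le> e + Suc L"
        by (simp add: hook_basis_Suc_right_eq[OF that])
    qed simp
  qed
  moreover have "insert (int (Suc L)) (entries 0 L) = entries 0 (Suc L)"
    by (auto simp: entries_def)
  ultimately show ?case
    by simp
qed

lemma expansion_entries:
  assumes p: "shape n p"
  shows "expansion (signed a) n p (entries K L) (shape_det n (hook_values a 0 0 n) p) (hook_values a K L n)"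
proof (induction K)
  case 0
  show ?case
    by (rule expansion_right_entries[OF p])
next
  case (Suc K)
  have "expansion (signed a) n p (insert (- int K) (entries K L))
      (shape_det n (hook_values a 0 0 n) p) (hook_values a (Suc K) L n)"
  proof (rule expansion_insert[OF p finite_entries _ Suc])
    show "final_entry (- int K) (entries K L)"
      by (auto simp: final_entry_def entries_def)
    fix r assume r: "shape n r"
    show "shape_det n (hook_values a K L n) r = (\<Sum>q | shape n q \<and> strip (- int K) r q.
        Const (signed a (- int K)) ^ card (boxes q - boxes r) * shape_det n (hook_values a (Suc K) L n) q)"
    proof (rule vertical_strip_expansion[OF r])
      fix i e
      show "hook_values a K L n i e = hook_values a (Suc K) L n i e
          + Const (signed a (- int K)) * hook_values a (Suc K) L n i (Suc e)" if "n + K \<le> e"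
        by (subst hook_basis_Suc_left[OF that])
          (simp add: signed_def divdiff_diff divdiff_const_mult Const_uminus)
      show "hook_values a K L n i e = hook_values a (Suc K) L n i e" if "e < n + K"
        by (simp add: hook_basis_Suc_left_eq[OF that])
    qed
  qed
  moreover have "insert (- int K) (entries K L) = entries (Suc K) L"
    by (auto simp: entries_def lessThan_Suc)
  ultimately show ?case
    by simp
qed


section \<open>Dual hook tableaux\<close>

lemma shape_part:
  assumes "is_partition la" "length la \<le> n"
  shows "shape n (part la)"
  using assms part_antimono[OF assms(1)] by (auto simp: shape_def) (simp_all add: part_def)

lemma part_inject:
  assumes "is_partition la" "is_partition la'" "part la = part la'"
  shows "la = la'"
proof (rule nth_equalityI)
  have "{1..length la} = {i. 0 < part la i}" "{1..length la'} = {i. 0 < part la' i}"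
    using assms(1,2) by (auto simp: part_pos_iff)
  then have "card {1..length la} = card {1..length la'}"
    using assms(3) by simp
  then show len: "length la = length la'"
    by simp
  fix i assume "i < length la"
  then show "la ! i = la' ! i"
    using len fun_cong[OF assms(3), of "Suc i"] by (simp add: part_def)
qed

lemma shape_imp_part:
  assumes q: "shape n q"
  obtains la where "is_partition la" "length la \<le> n" "part la = q"
proof
  define k where "k = card {i. 1 \<le> i \<and> q i \<noteq> 0}"
  let ?la = "map q [1..<Suc k]"
  have sub: "{i. 1 \<le> i \<and> q i \<noteq> 0} \<subseteq> {1..n}"
    using q by (auto simp: shape_def not_less[symmetric])
  then have fin: "finite {i. 1 \<le> i \<and> q i \<noteq> 0}"
    by (rule finite_subset) simp
  have k: "{i. 1 \<le> i \<and> q i \<noteq> 0} = {1..k}"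
    unfolding k_def
  proof (rule downset_eq_atLeastAtMost[OF fin])
    fix i j assume "i \<in> {i. 1 \<le> i \<and> q i \<noteq> 0}" "1 \<le> j" "j \<le> i"
    then show "j \<in> {i. 1 \<le> i \<and> q i \<noteq> 0}"
      using shape_antimono[OF q, of j i] by auto
  qed auto
  have pos: "0 < q i \<longleftrightarrow> i \<in> {1..k}" for i
    unfolding k[symmetric] using q by (cases i) (auto simp: shape_def)
  show "length ?la \<le> n"
    using card_mono[OF _ sub] by (simp add: k_def)
  have "0 \<notin> set ?la"
  proof
    assume "0 \<in> set ?la"
    then obtain i where "i \<in> {1..k}" "q i = 0"
      by (auto simp: less_Suc_eq_le simp del: upt_Suc)
    then show False
      using pos[of i] by simp
  qed
  then show "is_partition ?la"
    unfolding is_partition_def sorted_wrt_iff_nth_less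
    using shape_antimono[OF q] by (auto simp del: upt_Suc)
  show "part ?la = q"
  proof
    fix i
    show "part ?la i = q i"
      using pos[of i] by (auto simp: part_def simp del: upt_Suc)
  qed
qed

lemma boxes_part: "boxes (part la) = diagram la"
  by (simp add: boxes_def diagram_def)

lemma mem_diagram_iff_conj_part:
  assumes "is_partition la" "1 \<le> j"
  shows "(i, j) \<in> diagram la \<longleftrightarrow> 1 \<le> i \<and> i \<le> conj_part la j"
proof -
  have sub: "{i. (i, j) \<in> diagram la} \<subseteq> {1..length la}"
    using assms part_pos_iff[OF assms(1)] by (fastforce simp: diagram_def)
  have A: "{i. (i, j) \<in> diagram la} = {1..card {i. (i, j) \<in> diagram la}}"
  proof (rule downset_eq_atLeastAtMost)
    show "finite {i. (i, j) \<in> diagram la}"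
      using sub by (rule finite_subset) simp
    fix i k assume "i \<in> {i. (i, j) \<in> diagram la}" "1 \<le> k" "k \<le> i"
    then show "k \<in> {i. (i, j) \<in> diagram la}"
      using part_antimono[OF assms(1), of k i] by (auto simp: diagram_def)
  qed (auto simp: diagram_def)
  have "i \<in> {i. (i, j) \<in> diagram la} \<longleftrightarrow> i \<in> {1..conj_part la j}"
    unfolding conj_part_def by (rule arg_cong[OF A])
  then show ?thesis
    by simp
qed

context
  fixes la mu :: "nat list" and d :: nat
  assumes la: "is_partition la" and mu: "is_partition mu" and sub: "diagram mu \<subseteq> diagram la"
    and d_la: "diag_boxes la = d" and d_mu: "diag_boxes mu = d"
begin

text \<open>The two diagrams share their diagonal: for \<open>i \<le> d\<close> the box
  \<open>(i, i)\<close> lies in \<open>mu\<close>, so a new box is to its right; conversely, a box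
  to the right of the diagonal forces \<open>(i, i)\<close> into \<open>la\<close>.\<close>

lemma skew_row_iff:
  assumes b: "(i, j) \<in> skew la mu"
  shows "i \<le> d \<longleftrightarrow> i < j"
proof
  have i: "1 \<le> i" "1 \<le> j" "j \<le> part la i" "\<not> j \<le> part mu i"
    using b by (auto simp: skew_def diagram_def)
  show "i < j" if "i \<le> d"
    using le_diag_boxes_iff[OF mu i(1)] that i by (simp add: d_mu)
  show "i \<le> d" if "i < j"
    using le_diag_boxes_iff[OF la i(1)] that i by (simp add: d_la)
qed

lemma skew_col_iff:
  assumes b: "(i, j) \<in> skew la mu"
  shows "j \<le> d \<longleftrightarrow> j < i"
proof
  have i: "1 \<le> i" "1 \<le> j" "j \<le> part la i" "\<not> j \<le> part mu i"
    using b by (auto simp: skew_def diagram_def)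
  show "j < i" if "j \<le> d"
    using le_diag_boxes_iff[OF mu i(2)] part_antimono[OF mu i(1), of j] that i
    by (auto simp: d_mu not_less[symmetric])
  show "j \<le> d" if "j < i"
    using le_diag_boxes_iff[OF la i(2)] part_antimono[OF la i(2), of i] that i by (simp add: d_la)
qed

lemma skew_not_diagonal: "(i, i) \<notin> skew la mu"
  using skew_row_iff[of i i] skew_col_iff[of i i] le_diag_boxes_iff[OF la, of i]
  by (auto simp: skew_def diagram_def d_la)

text \<open>Entries drop by at least one per step up to the end of the row, where the value is at
  least \<open>i - part la i + 1\<close>; over the \<open>part la i - j\<close> steps this gives at
  least \<open>i - j + 1\<close> at \<open>(i, j)\<close>.\<close>

lemma dual_hook_tableaux_row_flag:
  assumes T: "T \<in> dual_hook_tableaux la mu" and b: "(i, j) \<in> skew la mu" "i < j"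
  shows "T (i, j) \<le> 0" "int i - int j < T (i, j)"
proof -
  have i: "1 \<le> i" "1 \<le> j" "j \<le> part la i" "\<not> j \<le> part mu i" "i \<le> d"
    using b skew_row_iff[OF b(1)] by (auto simp: skew_def diagram_def)
  have mem: "(i, k) \<in> skew la mu" if "j \<le> k" "k \<le> part la i" for k
    using that i by (auto simp: skew_def diagram_def)
  have strict: "\<And>k k'. (i, k) \<in> skew la mu \<Longrightarrow> (i, k') \<in> skew la mu \<Longrightarrow> k < k' \<Longrightarrow> T (i, k') < T (i, k)"
    and range: "\<And>k. (i, k) \<in> skew la mu \<Longrightarrow> T (i, k) \<in> {int i - int (part la i) + 1..0}"
    using T i(5) unfolding dual_hook_tableaux_def Let_def d_mu by auto
  show "T (i, j) \<le> 0"
    using range[OF b(1)] by simp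
  have "T (i, k) + int (k - j) \<le> T (i, j)" if "j \<le> k" "k \<le> part la i" for k
    using that
  proof (induction k rule: dec_induct)
    case (step k)
    then show ?case
      using strict[of k "Suc k"] mem by (simp add: Suc_diff_le)
  qed simp
  from this[OF i(3)] show "int i - int j < T (i, j)"
    using range[OF mem[OF i(3)]] i(3) by simp
qed

lemma dual_hook_tableaux_col_flag:
  assumes T: "T \<in> dual_hook_tableaux la mu" and b: "(i, j) \<in> skew la mu" "j < i"
  shows "1 \<le> T (i, j)" "T (i, j) \<le> int i - int j"
proof -
  have i: "1 \<le> i" "1 \<le> j" "(i, j) \<in> diagram la" "(i, j) \<notin> diagram mu" "j \<le> d"
    using b skew_col_iff[OF b(1)] by (auto simp: skew_def diagram_def)
  have i': "i \<le> conj_part la j"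
    using i mem_diagram_iff_conj_part[OF la i(2)] by simp
  have mem: "(k, j) \<in> skew la mu" if "i \<le> k" "k \<le> conj_part la j" for k
    using that i mem_diagram_iff_conj_part[OF la i(2), of k] part_antimono[OF mu i(1), of k]
    by (auto simp: skew_def) (auto simp: diagram_def)
  have strict: "\<And>k k'. (k, j) \<in> skew la mu \<Longrightarrow> (k', j) \<in> skew la mu \<Longrightarrow> k < k' \<Longrightarrow> T (k, j) < T (k', j)"
    and range: "\<And>k. (k, j) \<in> skew la mu \<Longrightarrow> T (k, j) \<in> {1..int (conj_part la j) - int j}"
    using T i(5) unfolding dual_hook_tableaux_def Let_def d_mu by auto
  show "1 \<le> T (i, j)"
    using range[OF b(1)] by simp
  have "T (i, j) + int (k - i) \<le> T (k, j)" if "i \<le> k" "k \<le> conj_part la j" for k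
    using that
  proof (induction k rule: dec_induct)
    case (step k)
    then show ?case
      using strict[of k "Suc k"] mem by (simp add: Suc_diff_le)
  qed simp
  from this[OF i'] show "T (i, j) \<le> int i - int j"
    using range[OF mem[OF i']] i' by simp
qed

text \<open>Flags give back the row bounds because \<open>j \<le> part la i\<close>, and the column
  bounds because \<open>i \<le> conj_part la j\<close>. \<open>K\<close> and \<open>n\<close> are
  large enough for \<open>entries K n\<close> to contain every value that a flag permits in
  \<open>la\<close>.\<close>

lemma fillings_eq_dual_hook_tableaux:
  assumes K: "part la 1 \<le> K" and n: "length la \<le> n"
  shows "fillings (entries K n) (part la) (part mu) = dual_hook_tableaux la mu"
proof (intro equalityI subsetI)
  fix T assume T: "T \<in> dual_hook_tableaux la mu"
  have valid: "T (i, j) \<in> entries K n \<and> flag (T (i, j)) (i, j)" if b: "(i, j) \<in> skew la mu" for i j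
  proof -
    have i: "1 \<le> i" "1 \<le> j" "j \<le> part la i"
      using b by (auto simp: skew_def diagram_def)
    consider "i < j" | "j < i"
      using skew_not_diagonal[of i] b by (cases i j rule: linorder_cases) auto
    then show ?thesis
    proof cases
      case 1
      note T = dual_hook_tableaux_row_flag[OF T b 1]
      have "j \<le> K"
        using i K part_antimono[OF la, of 1 i] by simp
      then have "T (i, j) = - int (nat (- T (i, j)))" "nat (- T (i, j)) < K"
        using T i by auto
      then have "T (i, j) \<in> entries K n"
        unfolding entries_def by blast
      then show ?thesis
        using T by (simp add: flag_def)
    next
      case 2
      note T = dual_hook_tableaux_col_flag[OF T b 2]
      have "i \<le> n"
        using i n part_pos_iff[OF la, of i] by simp
      then show ?thesis
        using T by (simp add: flag_def entries_def)
    qed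
  qed
  have row: "row_rel (T (i, j)) (T (i, j'))"
    if b: "(i, j) \<in> skew la mu" "(i, j') \<in> skew la mu" "j < j'" for i j j'
  proof (cases "i \<le> d")
    case True
    then have "T (i, j') < T (i, j)"
      using T b unfolding dual_hook_tableaux_def Let_def d_mu by auto
    then show ?thesis
      using dual_hook_tableaux_row_flag[OF T b(1)] True skew_row_iff[OF b(1)] by (simp add: row_rel_def)
  next
    case False
    then have "j < i" "j' < i"
      using skew_row_iff[OF b(1)] skew_row_iff[OF b(2)] skew_not_diagonal[of i] b
      by (metis linorder_neqE_nat)+
    then have "j \<le> d" "j' \<le> d"
      using skew_col_iff[OF b(1)] skew_col_iff[OF b(2)] by auto
    then have "T (i, j) \<le> T (i, j')"
      using T b unfolding dual_hook_tableaux_def Let_def d_mu by auto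
    then show ?thesis
      using dual_hook_tableaux_col_flag[OF T b(1) \<open>j < i\<close>] by (simp add: row_rel_def)
  qed
  have col: "col_rel (T (i, j)) (T (i', j))"
    if b: "(i, j) \<in> skew la mu" "(i', j) \<in> skew la mu" "i < i'" for i i' j
  proof (cases "j \<le> d")
    case True
    then have "T (i, j) < T (i', j)"
      using T b unfolding dual_hook_tableaux_def Let_def d_mu by auto
    then show ?thesis
      using dual_hook_tableaux_col_flag[OF T b(1)] True skew_col_iff[OF b(1)] by (simp add: col_rel_def)
  next
    case False
    then have "i < j" "i' < j"
      using skew_col_iff[OF b(1)] skew_col_iff[OF b(2)] skew_not_diagonal[of j] b
      by (metis linorder_neqE_nat)+
    then have "i \<le> d" "i' \<le> d"
      using skew_row_iff[OF b(1)] skew_row_iff[OF b(2)] by auto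
    then have "T (i', j) \<le> T (i, j)"
      using T b unfolding dual_hook_tableaux_def Let_def d_mu by auto
    then show ?thesis
      using dual_hook_tableaux_row_flag[OF T b(1) \<open>i < j\<close>] by (simp add: col_rel_def)
  qed
  have "T \<in> extensional (skew la mu)"
    using T by (simp add: dual_hook_tableaux_def)
  then show "T \<in> fillings (entries K n) (part la) (part mu)"
    using valid row col unfolding fillings_def boxes_part skew_def[symmetric] by auto
next
  fix T assume "T \<in> fillings (entries K n) (part la) (part mu)"
  note T = fillingsD[OF this, unfolded boxes_part, folded skew_def]
  have R: "i < j \<and> T (i, j) \<le> 0 \<and> T (i, j) \<in> {int i - int (part la i) + 1..0}"
    if b: "(i, j) \<in> skew la mu" "i \<le> d" for i j
    using T(3)[OF b(1)] skew_row_iff[OF b(1)] b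
    by (auto simp: flag_def skew_def diagram_def split: if_splits)
  have C: "j < i \<and> 0 < T (i, j) \<and> T (i, j) \<in> {1..int (conj_part la j) - int j}"
    if b: "(i, j) \<in> skew la mu" "j \<le> d" for i j
  proof -
    have "j < i"
      using skew_col_iff[OF b(1)] b by simp
    moreover have "i \<le> conj_part la j"
      using b(1) mem_diagram_iff_conj_part[OF la, of j i] by (auto simp: skew_def diagram_def)
    ultimately show ?thesis
      using T(3)[OF b(1)] by (auto simp: flag_def split: if_splits)
  qed
  have "T (i, j') < T (i, j)" if "j < j'" "(i, j) \<in> skew la mu" "(i, j') \<in> skew la mu" "i \<le> d" for i j j'
    using T(4)[of i j j'] R[of i j] that by (simp add: row_rel_def)
  moreover have "T (i', j) \<le> T (i, j)" if "i < i'" "(i, j) \<in> skew la mu" "i \<le> d" "(i', j) \<in> skew la mu" "i' \<le> d" for i i' j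
    using T(5)[of i j i'] R[of i j] that by (simp add: col_rel_def)
  moreover have "T (i, j) \<in> {int i - int (part la i) + 1..0}" if "(i, j) \<in> skew la mu" "i \<le> d" for i j
    using R[OF that] by simp
  moreover have "T (i, j) < T (i', j)" if "i < i'" "(i, j) \<in> skew la mu" "j \<le> d" "(i', j) \<in> skew la mu" for i i' j
    using T(5)[of i j i'] C[of i j] that by (simp add: col_rel_def)
  moreover have "T (i, j) \<le> T (i, j')" if "j < j'" "(i, j) \<in> skew la mu" "j \<le> d" "(i, j') \<in> skew la mu" "j' \<le> d" for i j j'
    using T(4)[of i j j'] C[of i j] that by (simp add: row_rel_def)
  moreover have "T (i, j) \<in> {1..int (conj_part la j) - int j}" if "(i, j) \<in> skew la mu" "j \<le> d" for i j
    using C[OF that] by simp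
  ultimately show "T \<in> dual_hook_tableaux la mu"
    unfolding dual_hook_tableaux_def Let_def d_mu using T(1)
    by (auto simp del: atLeastAtMost_iff)
qed

lemma weight_eq_psi:
  assumes "part la 1 \<le> K" "length la \<le> n"
  shows "weight (signed a) (entries K n) (part la) (part mu) = (-1) ^ row_boxes la mu * psi a la mu"
proof -
  have fin: "finite (skew la mu)"
    unfolding skew_def boxes_part[symmetric] by (rule finite_boxes_diff[OF shape_part[OF la order_refl]])
  have "(\<Prod>b\<in>skew la mu. signed a (T b)) = (-1) ^ row_boxes la mu * (\<Prod>b\<in>skew la mu. a (T b))"
    if T: "T \<in> dual_hook_tableaux la mu" for T
  proof -
    have "signed a (T b) = (if b \<in> {(i, j). i \<le> d} then -1 else 1) * a (T b)" if "b \<in> skew la mu" for b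
    proof (cases b)
      case (Pair i j)
      then have b: "(i, j) \<in> skew la mu"
        using that by simp
      then consider "i < j" | "j < i"
        using skew_not_diagonal[of i] by (cases i j rule: linorder_cases) auto
      then show ?thesis
      proof cases
        case 1
        then show ?thesis
          using dual_hook_tableaux_row_flag[OF T b 1] skew_row_iff[OF b] Pair by (simp add: signed_def)
      next
        case 2
        then show ?thesis
          using dual_hook_tableaux_col_flag[OF T b 2] skew_row_iff[OF b] Pair by (simp add: signed_def)
      qed
    qed
    then have "(\<Prod>b\<in>skew la mu. signed a (T b))
        = (\<Prod>b\<in>skew la mu. if b \<in> {(i, j). i \<le> d} then -1 else 1) * (\<Prod>b\<in>skew la mu. a (T b))"
      by (simp flip: prod.distrib)
    also have "(\<Prod>b\<in>skew la mu. if b \<in> {(i, j). i \<le> d} then -1 else 1 :: 'a)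
        = (-1) ^ card (skew la mu \<inter> {(i, j). i \<le> d})"
      by (subst prod.If_cases[OF fin]) (simp_all add: Int_def)
    also have "skew la mu \<inter> {(i, j). i \<le> d} = {(i, j) \<in> skew la mu. i \<le> d}"
      by auto
    finally show ?thesis
      by (simp add: row_boxes_def d_mu)
  qed
  then show ?thesis
    unfolding weight_def psi_def fillings_eq_dual_hook_tableaux[OF assms] boxes_part skew_def[symmetric]
      sum_distrib_left
    by (rule sum.cong[OF refl])
qed

end

text \<open>This restricts the expansion to diagrams with equally many diagonal boxes: otherwise the
  skew diagram has a diagonal box, and no value may fill it.\<close>

lemma weight_eq_0:
  assumes la: "is_partition la" and mu: "is_partition mu" and sub: "diagram mu \<subseteq> diagram la"
    and d: "diag_boxes la \<noteq> diag_boxes mu"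
  shows "weight a V (part la) (part mu) = 0"
proof -
  have "\<exists>i. (i, i) \<in> diagram la - diagram mu"
  proof (rule ccontr)
    assume "\<nexists>i. (i, i) \<in> diagram la - diagram mu"
    then have "{i. (i, i) \<in> diagram la} = {i. (i, i) \<in> diagram mu}"
      using sub by auto
    then show False
      using d by (simp add: diag_boxes_def)
  qed
  then obtain i where "(i, i) \<in> boxes (part la) - boxes (part mu)"
    by (auto simp: boxes_part)
  then have "fillings V (part la) (part mu) = {}"
    using fillingsD(3) not_flag_diagonal by blast
  then show ?thesis
    by (simp add: weight_def)
qed


section \<open>The expansion of Schur functions\<close>

lemma part_le_iff_diagram: "(\<forall>i. part mu i \<le> part la i) \<longleftrightarrow> diagram mu \<subseteq> diagram la"
  using shape_le_iff_boxes[of "part mu" "part la"] by (simp add: boxes_part part_def)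

text \<open>The first column has exponent \<open>q 1 + n - 1\<close>, of which the division takes
  away \<open>n - 1\<close>.\<close>

lemma coef_quot_shape_det_eq_0:
  assumes q: "shape n q" and b: "\<And>e k. k < e \<Longrightarrow> fps_nth (b e) k = 0" and m: "mdeg m < q 1"
  shows "coef (quot (shape_det n (\<lambda>i e. subst_var i (b e)) q) (vandermonde n)) m = 0"
proof -
  have "0 < n"
    using q m by (cases n) (auto simp: shape_def)
  then have "order_ge (q 1) (quot (shape_det n (\<lambda>i e. subst_var i (b e)) q) (vandermonde n))"
    by (intro order_ge_quot_alternant[of 0 n]) (auto intro: b)
  then show ?thesis
    using m by (simp add: order_ge_def)
qed

lemma coef_dual_schur_eq_0:
  assumes la: "is_partition la" and keys: "Poly_Mapping.keys m \<subseteq> {..<n}"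
    and "n < length la \<or> mdeg m < part la 1"
  shows "coef (dual_schur a la) m = 0"
proof (cases "n < length la")
  case True
  then show ?thesis
    by (simp add: coef_dual_schur[OF la keys] dual_schur_vars_def)
next
  case False
  then show ?thesis
    using assms coef_quot_shape_det_eq_0[of n "part la" "dual_basis a n" m]
    by (simp add: coef_dual_schur[OF la keys] dual_schur_vars_eq[OF la] shape_part
        dual_basis_def fps_nth_hook_basis)
qed

text \<open>A shape whose first row exceeds the degree of \<open>m\<close> contributes 0 whether or
  not its columns are truncated at \<open>K\<close>. For the others all exponents are below
  \<open>n + K\<close>, so the truncated columns are those of the dual Schur function.\<close>

lemma schur_coef_expansion:
  fixes a :: "int \<Rightarrow> 'a::comm_ring_1"
  assumes mu: "is_partition mu" and n: "length mu \<le> n" and keys: "Poly_Mapping.keys m \<subseteq> {..<n}"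
    and K: "mdeg m < K"
  obtains A where "finite A"
    and "\<And>la. la \<in> A \<Longrightarrow> is_partition la \<and> length la \<le> n \<and> diagram mu \<subseteq> diagram la"
    and "\<And>la. is_partition la \<Longrightarrow> length la \<le> n \<Longrightarrow> diagram mu \<subseteq> diagram la \<Longrightarrow> la \<notin> A \<Longrightarrow>
      weight (signed a) (entries K n) (part la) (part mu) = 0"
    and "coef (schur mu) m = (\<Sum>la\<in>A. weight (signed a) (entries K n) (part la) (part mu) * coef (dual_schur a la) m)"
proof -
  let ?w = "\<lambda>q. weight (signed a) (entries K n) q (part mu)"
  let ?Q = "\<lambda>q. quot (shape_det n (hook_values a K n n) q) (vandermonde n)"
  note p = shape_part[OF mu n]
  obtain A where A: "finite A" "\<And>q. q \<in> A \<Longrightarrow> shape n q" "\<And>q. q \<in> A \<Longrightarrow> \<forall>i. part mu i \<le> q i"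
    and A0: "\<And>q. shape n q \<Longrightarrow> \<forall>i. part mu i \<le> q i \<Longrightarrow> q \<notin> A \<Longrightarrow> ?w q = 0"
    and D: "shape_det n (hook_values a 0 0 n) (part mu) = (\<Sum>q\<in>A. Const (?w q) * shape_det n (hook_values a K n n) q)"
    using expansion_entries[OF p, of a K n] unfolding expansion_def
  proof (elim exE conjE)
    fix A
    assume *: "finite A" "\<forall>q\<in>A. shape n q \<and> (\<forall>i. part mu i \<le> q i)"
      "\<forall>q. shape n q \<and> (\<forall>i. part mu i \<le> q i) \<and> q \<notin> A \<longrightarrow> ?w q = 0"
      "shape_det n (hook_values a 0 0 n) (part mu) = (\<Sum>q\<in>A. Const (?w q) * shape_det n (hook_values a K n n) q)"
    show ?thesis
    proof (rule that[of A])
      show "shape n q" "\<forall>i. part mu i \<le> q i" if "q \<in> A" for q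
        using bspec[OF *(2) that] by simp_all
      show "?w q = 0" if "shape n q" "\<forall>i. part mu i \<le> q i" "q \<notin> A" for q
        using *(3)[rule_format, of q] that by simp
    qed (fact *)+
  qed
  define B where "B = {la. is_partition la \<and> length la \<le> n \<and> part la \<in> A}"
  have bij: "bij_betw part B A"
  proof (rule bij_betwI')
    show "part la = part la' \<longleftrightarrow> la = la'" if "la \<in> B" "la' \<in> B" for la la'
      using that part_inject by (auto simp: B_def)
    show "\<exists>la\<in>B. q = part la" if q: "q \<in> A" for q
      by (rule shape_imp_part[OF A(2)[OF q]]) (use q in \<open>auto simp: B_def\<close>)
  qed (simp add: B_def)
  have "schur mu = dual_schur (\<lambda>_. 0 :: 'a) mu"
    by (rule schur_eq_dual_schur[OF mu])
  then have "coef (schur mu) m = coef (quot (shape_det n (hook_values a 0 0 n) (part mu)) (vandermonde n)) m"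
    using n by (simp add: coef_dual_schur[OF mu keys] dual_schur_vars_eq[OF mu] dual_basis_zero hook_basis_0_0)
  also have "quot (shape_det n (hook_values a 0 0 n) (part mu)) (vandermonde n) = (\<Sum>q\<in>A. Const (?w q) * ?Q q)"
    by (rule quot_eqI[OF nonzerodiv_vandermonde])
      (simp only: D sum_distrib_right mult.assoc quot_alternant)
  also have "coef \<dots> m = (\<Sum>q\<in>A. ?w q * coef (?Q q) m)"
    by (simp add: coef_sum)
  also have "\<dots> = (\<Sum>la\<in>B. ?w (part la) * coef (?Q (part la)) m)"
    by (rule sum.reindex_bij_betw[OF bij, symmetric])
  also have "\<dots> = (\<Sum>la\<in>B. ?w (part la) * coef (dual_schur a la) m)"
  proof (rule sum.cong[OF refl])
    fix la assume "la \<in> B"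
    then have la: "is_partition la" "length la \<le> n"
      by (auto simp: B_def)
    have "coef (?Q (part la)) m = coef (dual_schur a la) m"
    proof (cases "mdeg m < part la 1")
      case True
      moreover have "coef (?Q (part la)) m = 0"
        by (rule coef_quot_shape_det_eq_0[OF shape_part[OF la] _ True]) (rule fps_nth_hook_basis)
      ultimately show ?thesis
        using coef_dual_schur_eq_0[OF la(1) keys, of a] by simp
    next
      case False
      have "shape_det n (hook_values a K n n) (part la)
          = alternant n (\<lambda>j. dual_basis a n (part la (Suc j) + (n - Suc j)))"
      proof (rule alternant_cong, rule hook_basis_eq_dual_basis)
        fix j assume "j < n"
        have "part la (Suc j) \<le> part la 1"
          by (rule part_antimono[OF la(1)]) auto
        then show "part la (Suc j) + (n - Suc j) < n + K"
          using False K by simp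
      qed simp
      then show ?thesis
        using la by (simp add: coef_dual_schur[OF la(1) keys] dual_schur_vars_eq)
    qed
    then show "?w (part la) * coef (?Q (part la)) m = ?w (part la) * coef (dual_schur a la) m"
      by simp
  qed
  finally have coef: "coef (schur mu) m = (\<Sum>la\<in>B. ?w (part la) * coef (dual_schur a la) m)" .
  show ?thesis
  proof (rule that[OF _ _ _ coef])
    show "finite B"
      using A(1) bij by (simp add: bij_betw_finite)
    show "is_partition la \<and> length la \<le> n \<and> diagram mu \<subseteq> diagram la" if "la \<in> B" for la
      using that A(3) part_le_iff_diagram[of mu la] by (auto simp: B_def)
    show "?w (part la) = 0"
      if "is_partition la" "length la \<le> n" "diagram mu \<subseteq> diagram la" "la \<notin> B" for la
      using that A0[of "part la"] shape_part part_le_iff_diagram[of mu la] by (auto simp: B_def)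
  qed
qed

text \<open>The number \<open>n\<close> of variables and the cutoff \<open>K\<close> depend on the
  monomial \<open>m\<close>, but the coefficient of any \<open>la\<close> in the index set that
  reaches \<open>m\<close> does not: its weight is the signed \<open>psi\<close>.\<close>

lemma schur_has_formal_sum:
  fixes a :: "int \<Rightarrow> 'a::comm_ring_1"
  assumes mu: "is_partition mu" and d: "diag_boxes mu = d"
  shows "has_formal_sum
           (\<lambda>la. Const ((-1) ^ row_boxes la mu * psi a la mu) * dual_schur a la)
           {la. is_partition la \<and> diagram mu \<subseteq> diagram la \<and> diag_boxes la = d}
           (schur mu)"
  unfolding has_formal_sum_def
proof (intro allI)
  fix m
  let ?I = "{la. is_partition la \<and> diagram mu \<subseteq> diagram la \<and> diag_boxes la = d}"
  let ?t = "\<lambda>la. coef (Const ((-1) ^ row_boxes la mu * psi a la mu) * dual_schur a la) m"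
  define n where "n = max (length mu) (Suc (Max (insert 0 (Poly_Mapping.keys m))))"
  define K where "K = Suc (mdeg m)"
  let ?w = "\<lambda>la. weight (signed a) (entries K n) (part la) (part mu)"
  have n: "length mu \<le> n"
    by (simp add: n_def)
  have keys: "Poly_Mapping.keys m \<subseteq> {..<n}"
    by (auto simp: n_def less_Suc_eq_le less_max_iff_disj)
  have K: "mdeg m < K"
    by (simp add: K_def)
  obtain A where A: "finite A"
    "\<And>la. la \<in> A \<Longrightarrow> is_partition la \<and> length la \<le> n \<and> diagram mu \<subseteq> diagram la"
    and A0: "\<And>la. is_partition la \<Longrightarrow> length la \<le> n \<Longrightarrow> diagram mu \<subseteq> diagram la \<Longrightarrow> la \<notin> A \<Longrightarrow> ?w la = 0"
    and coef: "coef (schur mu) m = (\<Sum>la\<in>A. ?w la * coef (dual_schur a la) m)"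
    by (rule schur_coef_expansion[OF mu n keys K, of a]) blast
  \<comment> \<open>These are the bounds under which the weight can be identified with the signed
    \<open>psi\<close>.\<close>
  have small: "length la \<le> n \<and> part la 1 \<le> K" if "is_partition la" "coef (dual_schur a la) m \<noteq> 0" for la
    using coef_dual_schur_eq_0[OF that(1) keys, of a] that(2) K by (meson less_imp_le not_le order_trans)
  have w: "?w la = (-1) ^ row_boxes la mu * psi a la mu"
    if "la \<in> ?I" "coef (dual_schur a la) m \<noteq> 0" for la
    using weight_eq_psi[of la mu d K n a] small[of la] that mu d by simp
  have t: "?w la * coef (dual_schur a la) m = (if la \<in> ?I then ?t la else 0)" if "la \<in> A" for la
  proof (cases "la \<in> ?I")
    case True
    then show ?thesis
      using w[of la] by (cases "coef (dual_schur a la) m = 0") auto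
  next
    case False
    then have "?w la = 0"
      using A(2)[OF that] mu d by (intro weight_eq_0) auto
    then show ?thesis
      by (simp only: False if_False mult_zero_left)
  qed
  \<comment> \<open>A nonzero summand has a nonzero weight, and weights vanish outside
    \<open>A\<close>; so the finite set \<open>A\<close> contains all contributing shapes.\<close>
  have sub: "{la \<in> ?I. ?t la \<noteq> 0} \<subseteq> A"
  proof
    fix la assume la: "la \<in> {la \<in> ?I. ?t la \<noteq> 0}"
    then have "coef (dual_schur a la) m \<noteq> 0" "(-1) ^ row_boxes la mu * psi a la mu \<noteq> 0"
      by auto
    then show "la \<in> A"
      using A0[of la] w[of la] small[of la] la by auto
  qed
  have "coef (schur mu) m = (\<Sum>la\<in>A. if la \<in> ?I then ?t la else 0)"
    unfolding coef by (rule sum.cong[OF refl t])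
  also have "\<dots> = (\<Sum>la\<in>{la \<in> ?I. ?t la \<noteq> 0}. ?t la)"
    by (rule sum.mono_neutral_cong_right[OF A(1) sub]) auto
  finally show "finite {la \<in> ?I. ?t la \<noteq> 0} \<and> coef (schur mu) m = (\<Sum>la\<in>{la \<in> ?I. ?t la \<noteq> 0}. ?t la)"
    using finite_subset[OF sub A(1)] by simp
qed

theorem theorem3p20:
  fixes mu :: "nat list" and d :: nat
  assumes "is_partition mu" and "diag_boxes mu = d"
  shows "has_formal_sum
           (\<lambda>la. Const ((-1) ^ row_boxes la mu * psi indet la mu) * dual_schur indet la)
           {la. is_partition la \<and> diagram mu \<subseteq> diagram la \<and> diag_boxes la = d}
           (schur mu)"
  using assms by (rule schur_has_formal_sum)

end
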